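(* Let $d\ge 2$, $L\ge 0$ be integers and $n=\dim\mathcal{P}_L(\mathbb{S}^d)=\binom{d+L}{d}+\binom{d+L-1}{d}$. If $\{\boldsymbol{x}_i\}_{i=1}^n$ is an $n$-point harmonic ensemble on $\mathbb{S}^d$, then \[ \mathbb{E}\big(\mathrm{FP}(\{\boldsymbol{x}_i\}_{i=1}^n)\big)=\frac{n^2}{d+1}+\left(\frac{d}{L+d}-\frac{d(d-1)}{(d+L)(d+2L+1)(d+2L-1)}\right)\binom{d+L}{d}, \] and in particular $\mathbb{E}(\mathrm{FP}(\{\boldsymbol{x}_i\}_{i=1}^n))=\frac{n^2}{d+1}+O(n^{(d-1)/d})$ as $n\to\infty$.
   Context: $\mathbb{S}^d=\{\boldsymbol{x}\in\mathbb{R}^{d+1}:\|\boldsymbol{x}\|=1\}$, $\sigma_d$ the normalized surface measure on $\mathbb{S}^d$. Frame potential: $\mathrm{FP}(\{\boldsymbol{x}_i\}_{i=1}^n)=\sum_{i,j=1}^n|\langle\boldsymbol{x}_i,\boldsymbol{x}_j\rangle|^2$. $\mathcal{P}_L(\mathbb{S}^d)$ is the space of polynomials of degree at most $L$ in $d+1$ variables restricted to $\mathbb{S}^d$. Let $C_\ell^{((d-1)/2)}$ be the Gegenbauer polynomial (orthogonal on $[-1,1]$ w.r.t. $(1-x^2)^{d/2-1}$), $Q_\ell(x)=\frac{d+2\ell-1}{d-1}C_\ell^{((d-1)/2)}(x)$ and $R_L(x)=\sum_{\ell=0}^L Q_\ell(x)$; $R_L(\langle\boldsymbol{x},\boldsymbol{y}\rangle)$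 is the reproducing kernel of $\mathcal{P}_L(\mathbb{S}^d)$ with respect to $\sigma_d$. A determinantal point process (DPP) on a space $S$ with reference measure $\mu$ and kernel $\mathcal{K}$ is a simple point process $\mathcal{X}$ whose $k$-point correlation functions are $\rho_k(\boldsymbol{x}_1,\dots,\boldsymbol{x}_k)=\det(\mathcal{K}(\boldsymbol{x}_i,\boldsymbol{x}_j))_{i,j\le k}$, i.e. $\mathbb{E}[\sum^{\neq}_{\boldsymbol{x}_1,\dots,\boldsymbol{x}_k\in\mathcal{X}}h(\boldsymbol{x}_1,\dots,\boldsymbol{x}_k)]=\int\rho_k h\,d\mu^{\otimes k}$ for all Borel $h\ge0$, the sum over pairwise distinct tuples. The harmonic ensemble on $\mathbb{S}^d$ is the DPP on $\mathbb{S}^d$ with respect to $\sigma_d$ with kernel $\mathcal{K}(\boldsymbol{x},\boldsymbol{y})=R_L(\langle\boldsymbol{x},\boldsymbol{y}\rangle)$; it has almost surely $n=R_L(1)$ points. *)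

theory Defs
  imports "HOL-Probability.Probability"
begin

text \<open>Normalized surface measure on the unit sphere of a Euclidean space, realised
  as the cone measure: push-forward of the uniform probability on the open unit ball
  under radial projection x / norm x.\<close>
definition sphere_measure :: "'a::euclidean_space measure" where
  "sphere_measure = distr (uniform_measure lborel (ball 0 1)) borel (\<lambda>x. x /\<^sub>R norm x)"

definition gegenbauer :: "real \<Rightarrow> nat \<Rightarrow> real \<Rightarrow> real" where
  "gegenbauer lam l x =
     (\<Sum>k\<le>l div 2. (-1)^k * pochhammer lam (l - k) / (fact k * fact (l - 2*k)) * (2*x)^(l - 2*k))"

definition Qpoly :: "nat \<Rightarrow> nat \<Rightarrow> real \<Rightarrow> real" where
  "Qpoly d l x = (real d + 2 * real l - 1) / (real d - 1) * gegenbauer ((real d - 1) / 2) l x"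

definition Rker :: "nat \<Rightarrow> nat \<Rightarrow> real \<Rightarrow> real" where
  "Rker d L x = (\<Sum>l\<le>L. Qpoly d l x)"

definition ldet :: "nat \<Rightarrow> (nat \<Rightarrow> nat \<Rightarrow> real) \<Rightarrow> real" where
  "ldet k A = (\<Sum>p\<in>{p. p permutes {..<k}}. of_int (sign p) * (\<Prod>i<k. A i (p i)))"

definition frame_potential :: "nat \<Rightarrow> (nat \<Rightarrow> 'a::real_inner) \<Rightarrow> real" where
  "frame_potential n x = (\<Sum>i<n. \<Sum>j<n. (x i \<bullet> x j)^2)"

text \<open>An n-point harmonic ensemble on S^d (ambient space 'a of dimension d+1),
  given as a random n-tuple X on the probability space M (the labelling is irrelevant):
  a simple point process on the sphere whose k-point correlation functions w.r.t.
  sphere_measure are det (R_L(<y_a,y_b>))_{a,b<k}.\<close>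
definition harmonic_ensemble ::
    "nat \<Rightarrow> nat \<Rightarrow> nat \<Rightarrow> 'w measure \<Rightarrow> ('w \<Rightarrow> nat \<Rightarrow> 'a::euclidean_space) \<Rightarrow> bool" where
  "harmonic_ensemble d L n M X \<longleftrightarrow>
     prob_space M \<and>
     (\<forall>i<n. (\<lambda>\<omega>. X \<omega> i) \<in> borel_measurable M) \<and>
     (AE \<omega> in M. \<forall>i<n. X \<omega> i \<in> sphere 0 1) \<and>
     (AE \<omega> in M. inj_on (X \<omega>) {..<n}) \<and>
     (\<forall>k (h :: (nat \<Rightarrow> 'a) \<Rightarrow> ennreal).
        h \<in> borel_measurable (PiM {..<k} (\<lambda>_. sphere_measure)) \<longrightarrow>
        (\<integral>\<^sup>+ \<omega>. (\<Sum>i\<in>{i\<in>{..<k} \<rightarrow>\<^sub>E {..<n}. inj_on i {..<k}}.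
                     h (\<lambda>j\<in>{..<k}. X \<omega> (i j))) \<partial>M)
        = (\<integral>\<^sup>+ y. ennreal (ldet k (\<lambda>a b. Rker d L (y a \<bullet> y b))) * h y
              \<partial>PiM {..<k} (\<lambda>_. sphere_measure)))"

definition harm_dim :: "nat \<Rightarrow> nat \<Rightarrow> nat" where
  "harm_dim d L = ((d + L) choose d) + ((d + L - 1) choose d)"

end

theory Submission
  imports Defs
begin

text \<open>Since the points lie on the sphere, the diagonal of the frame potential contributes \<open>n\<close>, and
  the two-point correlation function \<open>n\<^sup>2 - R\<^sub>L(t)\<^sup>2\<close>, \<open>t = x \<bullet> y\<close>, gives the rest:
  the expectation is \<open>n + E[(n\<^sup>2 - R\<^sub>L(t)\<^sup>2) t\<^sup>2]\<close>, where \<open>t\<close> follows the law of a coordinate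
  of a uniform point on the sphere. Instead of computing the density of this law, we use only that
  \<open>E[(1 - t\<^sup>2) g'(t)] = d E[t g(t)]\<close> for polynomials \<open>g\<close>, a consequence of invariance under
  reflections. Together with the Gegenbauer differential equation it yields orthogonality, and the
  three-term recurrence shows that \<open>t R\<^sub>L\<close> differs from \<open>R\<^sub>L\<close> only by multiples of \<open>Q\<^sub>L\<close> and
  \<open>Q\<^sub>L\<^sub>+\<^sub>1\<close>, so that \<open>E[t\<^sup>2 R\<^sub>L(t)\<^sup>2]\<close> is explicit.\<close>

section \<open>Gegenbauer polynomials\<close>

text \<open>Extending the summands by zero beyond \<open>l div 2\<close> lets the recurrence be checked term by term.\<close>

definition geg_term :: "real \<Rightarrow> nat \<Rightarrow> nat \<Rightarrow> real \<Rightarrow> real" where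
  "geg_term lam l k x = (if 2 * k \<le> l
     then (-1)^k * pochhammer lam (l - k) / (fact k * fact (l - 2*k)) * (2*x)^(l - 2*k) else 0)"

lemma gegenbauer_conv_sum_geg_term:
  assumes "l div 2 \<le> N"
  shows "gegenbauer lam l x = (\<Sum>k\<le>N. geg_term lam l k x)"
proof -
  have "(\<Sum>k\<le>N. geg_term lam l k x) = (\<Sum>k\<le>l div 2. geg_term lam l k x)"
    using assms by (intro sum.mono_neutral_right) (auto simp: geg_term_def)
  also have "\<dots> = gegenbauer lam l x"
    unfolding gegenbauer_def by (intro sum.cong refl) (auto simp: geg_term_def)
  finally show ?thesis ..
qed

lemma geg_term_rec_0:
  "(real l + 2) * geg_term lam (l + 2) 0 x = 2 * (real l + 1 + lam) * x * geg_term lam (l + 1) 0 x"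
  by (simp add: geg_term_def pochhammer_Suc divide_simps) (simp add: algebra_simps)

text \<open>Term \<open>k + 1\<close> in degrees \<open>l + 2\<close> and \<open>l + 1\<close> is
  matched with term \<open>k\<close> in degree \<open>l\<close>, because all three then carry the
  power \<open>x^(l - 2*k)\<close>. At the boundary \<open>2 * k = l\<close> the middle term
  vanishes, so that case is separate.\<close>

lemma geg_term_rec_Suc:
  "(real l + 2) * geg_term lam (l + 2) (Suc k) x
     = 2 * (real l + 1 + lam) * x * geg_term lam (l + 1) (Suc k) x - (real l + 2 * lam) * geg_term lam l k x"
proof -
  consider "2 * k > l" | "2 * k = l" | "2 * k < l" by linarith
  then show ?thesis
  proof cases
    case 1
    then show ?thesis by (simp add: geg_term_def)
  next
    case 2
    then have l: "l = 2 * k" by simp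
    show ?thesis unfolding l
      by (simp add: geg_term_def pochhammer_Suc divide_simps) (simp add: algebra_simps)
  next
    case 3
    then obtain p where l: "l = p + 2 * k + 1"
      by (metis add.assoc add.commute less_iff_Suc_add plus_1_eq_Suc add_Suc_right Suc_eq_plus1)
    have e: "p + 2 * k + 1 - k = p + k + 1" "p + 2 * k + 2 - k = p + k + 2" by auto
    show ?thesis unfolding l
      by (simp add: geg_term_def pochhammer_Suc e divide_simps) (simp add: algebra_simps)
  qed
qed


lemma gegenbauer_0 [simp]: "gegenbauer lam 0 x = 1"
  by (simp add: gegenbauer_def)

lemma gegenbauer_1 [simp]: "gegenbauer lam (Suc 0) x = 2 * lam * x"
  by (simp add: gegenbauer_def)

lemma gegenbauer_rec:
  "(real l + 2) * gegenbauer lam (l + 2) x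
     = 2 * (real l + 1 + lam) * x * gegenbauer lam (l + 1) x - (real l + 2 * lam) * gegenbauer lam l x"
proof -
  have "(real l + 2) * gegenbauer lam (l + 2) x = (real l + 2) * (\<Sum>k\<le>Suc l. geg_term lam (l + 2) k x)"
    by (subst gegenbauer_conv_sum_geg_term[where N = "Suc l"]) auto
  also have "\<dots> = (real l + 2) * geg_term lam (l + 2) 0 x + (\<Sum>k\<le>l. (real l + 2) * geg_term lam (l + 2) (Suc k) x)"
    by (simp only: sum.atMost_Suc_shift distrib_left sum_distrib_left)
  also have "\<dots> = 2 * (real l + 1 + lam) * x * (\<Sum>k\<le>Suc l. geg_term lam (l + 1) k x)
      - (real l + 2 * lam) * (\<Sum>k\<le>l. geg_term lam l k x)"
    unfolding geg_term_rec_0 geg_term_rec_Suc sum_subtractf sum_distrib_left [symmetric] sum.atMost_Suc_shift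
    by (simp add: algebra_simps)
  also have "\<dots> = 2 * (real l + 1 + lam) * x * gegenbauer lam (l + 1) x - (real l + 2 * lam) * gegenbauer lam l x"
    by (subst (1 2) gegenbauer_conv_sum_geg_term[symmetric]) auto
  finally show ?thesis .
qed

section \<open>Derivatives and the differential equation\<close>

text \<open>Formal polynomials give access to \<open>pderiv\<close>, and the integration by parts
  formula below is stated for them.\<close>

fun gegenbauer_poly :: "real \<Rightarrow> nat \<Rightarrow> real poly" where
  "gegenbauer_poly lam 0 = 1"
| "gegenbauer_poly lam (Suc 0) = [:0, 2 * lam:]"
| "gegenbauer_poly lam (Suc (Suc l)) = smult (1 / (l + 2))
     ([:0, 2 * (real l + 1 + lam):] * gegenbauer_poly lam (Suc l) - smult (real l + 2 * lam) (gegenbauer_poly lam l))"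

lemma poly_gegenbauer_poly [simp]: "poly (gegenbauer_poly lam l) x = gegenbauer lam l x"
proof (induction lam l rule: gegenbauer_poly.induct)
  case (3 lam l)
  then show ?case
    using gegenbauer_rec[of l lam x] by (simp add: field_simps)
qed auto

abbreviation gegenbauer' :: "real \<Rightarrow> nat \<Rightarrow> real \<Rightarrow> real" where
  "gegenbauer' lam l x \<equiv> poly (pderiv (gegenbauer_poly lam l)) x"

abbreviation gegenbauer'' :: "real \<Rightarrow> nat \<Rightarrow> real \<Rightarrow> real" where
  "gegenbauer'' lam l x \<equiv> poly (pderiv (pderiv (gegenbauer_poly lam l))) x"

lemma gegenbauer'_rec:
  "(real l + 2) * gegenbauer' lam (l + 2) x = 2 * (real l + 1 + lam) * (gegenbauer lam (l + 1) x
     + x * gegenbauer' lam (l + 1) x) - (real l + 2 * lam) * gegenbauer' lam l x"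
  by (simp add: pderiv_smult pderiv_mult pderiv_diff pderiv_pCons) (simp add: field_simps)

text \<open>Both relations go through one induction: the second one in degree \<open>l\<close>,
  inserted in the differentiated recurrence, gives the first one for \<open>l + 1\<close>; this,
  both relations for \<open>l\<close> and the recurrence itself then give the second one for
  \<open>l + 1\<close>.\<close>

lemma gegenbauer'_raise_lower:
  "gegenbauer' lam (l + 1) x = x * gegenbauer' lam l x + (real l + 2 * lam) * gegenbauer lam l x"
  "x * gegenbauer' lam (l + 1) x - gegenbauer' lam l x = (real l + 1) * gegenbauer lam (l + 1) x"
proof (induction l)
  case 0
  {
    case 1 show ?case by (simp add: pderiv_pCons)
  next
    case 2 show ?case by (simp add: pderiv_pCons)
  }
next
  case (Suc l)
  note r' = gegenbauer'_rec[of l lam x] and r = gegenbauer_rec[of l lam x]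
  have 1: "gegenbauer' lam (l + 2) x = x * gegenbauer' lam (l + 1) x + (l + 1 + 2 * lam) * gegenbauer lam (l + 1) x"
  proof -
    have "(real l + 2) * gegenbauer' lam (l + 2) x = (real l + 2) * (x * gegenbauer' lam (l + 1) x + (l + 1 + 2 * lam) * gegenbauer lam (l + 1) x)"
      using r' Suc by (simp; algebra)
    then show ?thesis by simp
  qed
  have 2: "x * gegenbauer' lam (l + 2) x - gegenbauer' lam (l + 1) x = (real l + 2) * gegenbauer lam (l + 2) x"
    using r Suc 1 by (simp; algebra)
  { case 1 show ?case using \<open>gegenbauer' lam (l + 2) x = _\<close> by simp
  next case 2 show ?case using \<open>_ = (real l + 2) * gegenbauer lam (l + 2) x\<close> by simp
  }
qed

text \<open>Combining the two relations above gives a formula for \<open>1 - x^2\<close> times the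
  derivative of degree \<open>k + 1\<close> that involves no other derivative. Differentiating it
  once more and removing the derivative of degree \<open>k\<close> by the second relation yields the
  equation.\<close>

lemma gegenbauer_ode:
  "(1 - x^2) * gegenbauer'' lam l x - (2 * lam + 1) * x * gegenbauer' lam l x
     = - (l * (real l + 2 * lam)) * gegenbauer lam l x"
proof (cases l)
  case 0
  then show ?thesis by simp
next
  case (Suc k)
  let ?P = "gegenbauer_poly lam"
  have "[:1, 0, -1:] * pderiv (?P (k + 1))
      = smult (k + 2 * lam) (?P k) - smult (k + 1) ([:0, 1:] * ?P (k + 1))"
  proof (intro poly_eq_poly_eq_iff[THEN iffD1] ext)
    fix x :: real
    show "poly ([:1, 0, -1:] * pderiv (?P (k + 1))) x
        = poly (smult (k + 2 * lam) (?P k) - smult (k + 1) ([:0, 1:] * ?P (k + 1))) x"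
      using gegenbauer'_raise_lower[where lam = lam and l = k and x = x] by (simp; algebra)
  qed
  then have "poly (pderiv ([:1, 0, -1:] * pderiv (?P (k + 1)))) x
      = poly (pderiv (smult (k + 2 * lam) (?P k) - smult (k + 1) ([:0, 1:] * ?P (k + 1)))) x"
    by (simp only:)
  then have "(1 - x^2) * gegenbauer'' lam (k + 1) x - 2 * x * gegenbauer' lam (k + 1) x
      = (k + 2 * lam) * gegenbauer' lam k x
        - (real k + 1) * (gegenbauer lam (k + 1) x + x * gegenbauer' lam (k + 1) x)"
    by (simp add: pderiv_smult pderiv_mult pderiv_diff pderiv_pCons del: mult_pCons_left mult_pCons_right)
      (simp add: algebra_simps power2_eq_square)
  moreover have "gegenbauer' lam k x = x * gegenbauer' lam (k + 1) x - (real k + 1) * gegenbauer lam (k + 1) x"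
    using gegenbauer'_raise_lower(2)[where lam = lam and l = k and x = x] by (simp add: algebra_simps)
  ultimately have "(1 - x^2) * gegenbauer'' lam (k + 1) x - (2 * lam + 1) * x * gegenbauer' lam (k + 1) x
     = - ((real k + 1) * (real k + 1 + 2 * lam)) * gegenbauer lam (k + 1) x"
    by algebra
  then show ?thesis
    unfolding Suc by (simp add: add_ac)
qed

lemma continuous_on_gegenbauer [continuous_intros]:
  "continuous_on A f \<Longrightarrow> continuous_on A (\<lambda>x. gegenbauer lam l (f x))"
  unfolding gegenbauer_def by (intro continuous_intros)

lemma gegenbauer_rec':
  "(real l + 1) * gegenbauer lam (l + 1) x = 2 * (real l + lam) * x * gegenbauer lam l x
     - (if l = 0 then 0 else (real l + 2 * lam - 1) * gegenbauer lam (l - 1) x)"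
proof (cases l)
  case (Suc k)
  then show ?thesis using gegenbauer_rec[of k lam x] by (simp add: algebra_simps)
qed simp

lemma gegenbauer_at_1_Suc:
  "(real l + 1) * gegenbauer lam (l + 1) 1 = (real l + 2 * lam) * gegenbauer lam l 1"
proof (induction l)
  case (Suc l)
  then show ?case using gegenbauer_rec[of l lam 1] by (simp add: algebra_simps)
qed simp

section \<open>Orthogonality\<close>

text \<open>Collects what is used about the law of a coordinate on the sphere, with
  \<open>2 * lam + 1 = d\<close>. For the weight \<open>(1 - t^2)\<close> to the power
  \<open>lam - 1/2\<close> the last assumption is ordinary integration by parts without boundary
  terms.\<close>

locale gegenbauer_functional = prob_space \<nu> for \<nu> :: "real measure" +
  fixes lam :: real
  assumes sets_nu [simp, measurable_cong]: "sets \<nu> = sets borel"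
    and AE_nu: "AE t in \<nu>. \<bar>t\<bar> \<le> 1"
    and lam_pos: "lam > 0"
    and integration_by_parts:
      "\<And>g :: real poly. (\<integral>t. (1 - t^2) * poly (pderiv g) t \<partial>\<nu>) = (2 * lam + 1) * (\<integral>t. t * poly g t \<partial>\<nu>)"
begin

lemma integrable_continuous:
  assumes f: "continuous_on UNIV f"
  shows "integrable \<nu> (f :: real \<Rightarrow> real)"
proof -
  have "compact (f ` {-1..1})"
    using f by (intro compact_continuous_image) (auto intro: continuous_on_subset)
  then obtain B where "\<And>y. y \<in> {-1..1} \<Longrightarrow> norm (f y) \<le> B"
    using compact_imp_bounded by (metis bounded_iff imageI)
  then have "norm (f y) \<le> B" if "\<bar>y\<bar> \<le> 1" for y
    using that by (simp add: abs_le_iff)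
  with AE_nu have "AE y in \<nu>. norm (f y) \<le> B"
    by (rule eventually_mono)
  moreover have "f \<in> borel_measurable \<nu>"
    by (subst measurable_cong_sets[OF sets_nu refl]) (rule borel_measurable_continuous_onI[OF f])
  ultimately show ?thesis
    by (intro integrable_const_bound)
qed

abbreviation G :: "nat \<Rightarrow> real \<Rightarrow> real" where "G \<equiv> gegenbauer lam"

lemma integrable_gegenbauer_mult: "integrable \<nu> (\<lambda>t. G k t * G l t)"
  by (intro integrable_continuous continuous_intros)

text \<open>Integration by parts for the product of \<open>G k\<close> and the derivative of
  \<open>G l\<close>, with the second derivative of \<open>G l\<close> eliminated by the
  differential equation.\<close>

lemma gegenbauer_dirichlet_form:
  "(\<integral>t. (1 - t^2) * (gegenbauer' lam k t * gegenbauer' lam l t) \<partial>\<nu>)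
     = l * (l + 2 * lam) * (\<integral>t. G k t * G l t \<partial>\<nu>)"
proof -
  let ?P = "gegenbauer_poly lam"
  let ?g = "?P k * pderiv (?P l)"
  have int: "integrable \<nu> (\<lambda>t. (1 - t^2) * poly p t)" "integrable \<nu> (\<lambda>t. t * poly p t)" for p
    by (intro integrable_continuous continuous_intros)+
  have "(\<integral>t. (1 - t^2) * (gegenbauer' lam k t * gegenbauer' lam l t) \<partial>\<nu>)
      = (\<integral>t. (1 - t^2) * poly (pderiv ?g) t - (2 * lam + 1) * (t * poly ?g t)
          + l * (l + 2 * lam) * (G k t * G l t) \<partial>\<nu>)"
  proof (intro Bochner_Integration.integral_cong refl)
    fix t :: real
    show "(1 - t^2) * (gegenbauer' lam k t * gegenbauer' lam l t)
      = (1 - t^2) * poly (pderiv ?g) t - (2 * lam + 1) * (t * poly ?g t)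
          + l * (l + 2 * lam) * (G k t * G l t)"
      using gegenbauer_ode[of t lam l] by (simp add: pderiv_mult; algebra)
  qed
  also have "\<dots> = l * (l + 2 * lam) * (\<integral>t. G k t * G l t \<partial>\<nu>)"
    by (simp add: int integrable_gegenbauer_mult integration_by_parts del: poly_mult)
  finally show ?thesis .
qed

text \<open>The Dirichlet form is symmetric in \<open>k\<close> and \<open>l\<close>, and the
  eigenvalues \<open>l * (l + 2 * lam)\<close> are distinct because \<open>lam > 0\<close>.\<close>

lemma gegenbauer_orthogonal:
  assumes "k \<noteq> l"
  shows "(\<integral>t. G k t * G l t \<partial>\<nu>) = 0"
proof -
  have "k * (k + 2 * lam) * (\<integral>t. G k t * G l t \<partial>\<nu>) = l * (l + 2 * lam) * (\<integral>t. G k t * G l t \<partial>\<nu>)"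
    using gegenbauer_dirichlet_form[of k l] gegenbauer_dirichlet_form[of l k]
    by (simp only: mult.commute[of "G l _"] mult.commute[of "gegenbauer' lam l _"])
  then have "(real k - real l) * (real k + real l + 2 * lam) * (\<integral>t. G k t * G l t \<partial>\<nu>) = 0"
    by algebra
  moreover have "real k + real l + 2 * lam > 0" using lam_pos by simp
  ultimately show ?thesis using assms by auto
qed

text \<open>The integral of \<open>t * G l t * G (l + 1) t\<close> is computed twice, expanding
  \<open>t * G (l + 1) t\<close> or \<open>t * G l t\<close> by the recurrence. Orthogonality leaves
  one squared norm each time; the resulting ratio of norms is compared with the ratio of values at
  1.\<close>

lemma gegenbauer_norm:
  "(l + lam) * (\<integral>t. G l t * G l t \<partial>\<nu>) = lam * G l 1"
proof (induction l)
  case 0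
  then show ?case by (simp add: prob_space)
next
  case (Suc l)
  have "(l + 2 * lam) * (l + lam) * (\<integral>t. G l t * G l t \<partial>\<nu>)
      = (real l + 1) * (real l + 1 + lam) * (\<integral>t. G (l + 1) t * G (l + 1) t \<partial>\<nu>)"
  proof -
    have "2 * (l + lam) * (l + 2 * lam) * (\<integral>t. G l t * G l t \<partial>\<nu>)
       = 2 * (l + lam) * (\<integral>t. (real l + 2) * (G l t * G (l + 2) t) + (real l + 2 * lam) * (G l t * G l t) \<partial>\<nu>)"
      by (simp add: integrable_gegenbauer_mult gegenbauer_orthogonal)
    also have "(\<lambda>t. (real l + 2) * (G l t * G (l + 2) t) + (real l + 2 * lam) * (G l t * G l t))
       = (\<lambda>t. 2 * (real l + 1 + lam) * (t * G l t * G (l + 1) t))"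
    proof
      fix t
      show "(real l + 2) * (G l t * G (l + 2) t) + (real l + 2 * lam) * (G l t * G l t)
          = 2 * (real l + 1 + lam) * (t * G l t * G (l + 1) t)"
        using gegenbauer_rec[of l lam t] by algebra
    qed
    also have "2 * (real l + lam) * (\<integral>t. 2 * (real l + 1 + lam) * (t * G l t * G (l + 1) t) \<partial>\<nu>)
       = 2 * (real l + 1 + lam) * (\<integral>t. 2 * (real l + lam) * (t * G l t * G (l + 1) t) \<partial>\<nu>)"
      by simp
    also have "(\<lambda>t. 2 * (real l + lam) * (t * G l t * G (l + 1) t))
       = (\<lambda>t. (real l + 1) * (G (l + 1) t * G (l + 1) t)
            + (if l = 0 then 0 else real l + 2 * lam - 1) * (G (l - 1) t * G (l + 1) t))"
    proof
      fix t
      \<comment> \<open>For \<open>l = 0\<close> the index \<open>l - 1\<close> is truncated to 0;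
        the coefficient \<open>c\<close> is then 0, so the spurious term disappears.\<close>
      define c where "c = (if l = 0 then 0 else real l + 2 * lam - 1)"
      have "(real l + 1) * G (l + 1) t = 2 * (real l + lam) * t * G l t - c * G (l - 1) t"
        using gegenbauer_rec'[of l lam t] by (simp add: c_def)
      then show "2 * (real l + lam) * (t * G l t * G (l + 1) t)
        = (real l + 1) * (G (l + 1) t * G (l + 1) t)
            + (if l = 0 then 0 else real l + 2 * lam - 1) * (G (l - 1) t * G (l + 1) t)"
        unfolding c_def[symmetric] by algebra
    qed
    also have "(\<integral>t. (real l + 1) * (G (l + 1) t * G (l + 1) t)
            + (if l = 0 then 0 else real l + 2 * lam - 1) * (G (l - 1) t * G (l + 1) t) \<partial>\<nu>)
       = (real l + 1) * (\<integral>t. G (l + 1) t * G (l + 1) t \<partial>\<nu>)"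
      by (simp add: integrable_gegenbauer_mult gegenbauer_orthogonal)
    finally show ?thesis by algebra
  qed
  moreover have "(real l + 1) * G (l + 1) 1 = (l + 2 * lam) * G l 1"
    using gegenbauer_at_1_Suc[of l lam] by simp
  ultimately have "(real l + 1) * ((real l + 1 + lam) * (\<integral>t. G (l + 1) t * G (l + 1) t \<partial>\<nu>)) = (real l + 1) * (lam * G (l + 1) 1)"
    using Suc by algebra
  then show ?case by (simp add: add_ac)
qed

section \<open>The kernel as a function of one variable\<close>

text \<open>For \<open>lam = (d - 1) / 2\<close> this is \<open>Qpoly d\<close>. The factor makes
  the squared norm of \<open>Q l\<close> equal to \<open>Q l 1\<close>, as for a reproducing
  kernel.\<close>

definition Q :: "nat \<Rightarrow> real \<Rightarrow> real" where "Q l t = (l + lam) / lam * G l t"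

definition R :: "nat \<Rightarrow> real \<Rightarrow> real" where "R L t = (\<Sum>l\<le>L. Q l t)"

lemma continuous_on_Q [continuous_intros]: "continuous_on A f \<Longrightarrow> continuous_on A (\<lambda>x. Q l (f x))"
  unfolding Q_def using lam_pos by (intro continuous_intros) auto

lemma continuous_on_R [continuous_intros]: "continuous_on A f \<Longrightarrow> continuous_on A (\<lambda>x. R l (f x))"
  unfolding R_def by (intro continuous_intros) auto

lemma integral_Q_Q: "(\<integral>t. Q k t * Q l t \<partial>\<nu>) = (if k = l then Q l 1 else 0)"
proof -
  have "(\<integral>t. Q k t * Q l t \<partial>\<nu>) = (\<integral>t. ((k + lam) / lam * ((l + lam) / lam)) * (G k t * G l t) \<partial>\<nu>)"
    by (intro Bochner_Integration.integral_cong) (simp_all add: Q_def)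
  also have "\<dots> = (k + lam) / lam * ((l + lam) / lam) * (\<integral>t. G k t * G l t \<partial>\<nu>)"
    by simp
  also have "\<dots> = (if k = l then Q l 1 else 0)"
  proof (cases "k = l")
    case True
    have "(l + lam) / lam * ((l + lam) / lam) * (\<integral>t. G l t * G l t \<partial>\<nu>)
        = (l + lam) / lam * ((l + lam) * (\<integral>t. G l t * G l t \<partial>\<nu>)) / lam"
      by simp
    also have "\<dots> = Q l 1"
      unfolding gegenbauer_norm using lam_pos by (simp add: Q_def)
    finally show ?thesis using True by simp
  qed (simp add: gegenbauer_orthogonal)
  finally show ?thesis .
qed

lemma integral_R_Q: "(\<integral>t. R L t * Q l t \<partial>\<nu>) = (if l \<le> L then Q l 1 else 0)"
proof -
  have "(\<integral>t. R L t * Q l t \<partial>\<nu>) = (\<Sum>k\<le>L. (\<integral>t. Q k t * Q l t \<partial>\<nu>))"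
    unfolding R_def sum_distrib_right
    by (intro Bochner_Integration.integral_sum integrable_continuous continuous_intros)
  then show ?thesis by (simp add: integral_Q_Q)
qed

lemma integral_R_R: "(\<integral>t. R L t * R L t \<partial>\<nu>) = R L 1"
proof -
  have "(\<integral>t. R L t * R L t \<partial>\<nu>) = (\<integral>t. (\<Sum>l\<le>L. R L t * Q l t) \<partial>\<nu>)"
    by (simp add: R_def sum_distrib_left)
  also have "\<dots> = (\<Sum>l\<le>L. (\<integral>t. R L t * Q l t \<partial>\<nu>))"
    by (intro Bochner_Integration.integral_sum integrable_continuous continuous_intros)
  also have "\<dots> = R L 1"
    by (simp add: integral_R_Q) (simp add: R_def)
  finally show ?thesis .
qed

lemma mult_Q:
  "t * Q l t = (l + 1) / (2 * (l + 1 + lam)) * Q (l + 1) t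
     + (if l = 0 then 0 else (l - 1 + 2 * lam) / (2 * (l - 1 + lam)) * Q (l - 1) t)"
proof -
  have 1: "(real l + 1) / (2 * (real l + 1 + lam)) * Q (l + 1) t = (real l + 1) * G (l + 1) t / (2 * lam)"
    using lam_pos by (simp add: Q_def divide_simps)
  have 2: "(real l - 1 + 2 * lam) / (2 * (real l - 1 + lam)) * Q (l - 1) t
      = (real l + 2 * lam - 1) * G (l - 1) t / (2 * lam)" if "l \<noteq> 0"
  proof -
    have "real l - 1 + lam > 0" using that lam_pos by (simp add: add_nonneg_pos)
    moreover have "real (l - 1) = real l - 1" using that by simp
    ultimately show ?thesis using lam_pos by (simp add: Q_def divide_simps) (simp add: algebra_simps)
  qed
  have "t * Q l t = 2 * (real l + lam) * t * G l t / (2 * lam)"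
    using lam_pos by (simp add: Q_def divide_simps)
  also have "2 * (real l + lam) * t * G l t
      = (real l + 1) * G (l + 1) t + (if l = 0 then 0 else (real l + 2 * lam - 1) * G (l - 1) t)"
    using gegenbauer_rec'[of l lam t] by simp
  finally have *: "t * Q l t = ((real l + 1) * G (l + 1) t
      + (if l = 0 then 0 else (real l + 2 * lam - 1) * G (l - 1) t)) / (2 * lam)" .
  show ?thesis
  proof (cases "l = 0")
    case False
    show ?thesis
      unfolding * 1 2[OF False] using False by (simp only: add_divide_distrib if_False)
  qed (use * 1 in simp)
qed

text \<open>For \<open>l < L\<close>, the coefficients of \<open>Q l\<close> coming from
  \<open>t * Q (l - 1) t\<close> and \<open>t * Q (l + 1) t\<close> add up to 1, so these terms
  reproduce \<open>Q l\<close>. Only \<open>Q L\<close>, which lacks the contribution from above,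
  and \<open>Q (L + 1)\<close> deviate.\<close>

lemma mult_R:
  "t * R L t = R L t - (1 - L / (2 * (L + lam))) * Q L t + (real L + 1) / (2 * (real L + 1 + lam)) * Q (L + 1) t"
proof (induction L)
  case 0
  then show ?case using mult_Q[of t 0] by (simp add: R_def)
next
  case (Suc L)
  have "lam + real L > 0" using lam_pos by simp
  then have "(L + 2 * lam) / (2 * (L + lam)) = 1 - L / (2 * (L + lam))"
    by (simp add: field_simps)
  then have "t * Q (Suc L) t = (real L + 2) / (2 * (real L + 2 + lam)) * Q (Suc (Suc L)) t
     + (1 - L / (2 * (L + lam))) * Q L t"
    using mult_Q[of t "Suc L"] by (simp add: add_ac)
  then show ?case using Suc by (simp add: R_def algebra_simps)
qed

text \<open>Squaring \<open>mult_R\<close> gives six products; those of \<open>Q (L + 1)\<close>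
  with \<open>R L\<close> and with \<open>Q L\<close> integrate to 0, and the others to values at
  1.\<close>

lemma integral_R2_t2:
  "(\<integral>t. (t * R L t)^2 \<partial>\<nu>) = R L 1 - (1 - (L / (2 * (L + lam)))^2) * Q L 1
     + ((real L + 1) / (2 * (real L + 1 + lam)))^2 * Q (L + 1) 1"
proof -
  define a b where "a = 1 - L / (2 * (L + lam))" and "b = (real L + 1) / (2 * (real L + 1 + lam))"
  have i: "integrable \<nu> (\<lambda>t. Q k t * Q l t)" "integrable \<nu> (\<lambda>t. R k t * Q l t)"
    "integrable \<nu> (\<lambda>t. R k t * R l t)" for k l
    by (intro integrable_continuous continuous_intros)+
  have "(t * R L t)^2 = R L t * R L t - 2 * a * (R L t * Q L t) + 2 * b * (R L t * Q (L + 1) t)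
     + a^2 * (Q L t * Q L t) - 2 * a * b * (Q L t * Q (L + 1) t) + b^2 * (Q (L + 1) t * Q (L + 1) t)" for t
    unfolding mult_R[of t L, folded a_def b_def] by algebra
  then have "(\<integral>t. (t * R L t)^2 \<partial>\<nu>) = R L 1 - 2 * a * Q L 1 + a^2 * Q L 1 + b^2 * Q (L + 1) 1"
    by (simp add: i integral_R_R integral_R_Q integral_Q_Q)
  also have "\<dots> = R L 1 - (1 - (1 - a)^2) * Q L 1 + b^2 * Q (L + 1) 1"
    by (simp add: power2_eq_square algebra_simps)
  finally show ?thesis by (simp add: a_def b_def)
qed

lemma Rker_eq_R:
  assumes "lam = (real d - 1) / 2"
  shows "Rker d L = R L"
proof -
  have "(real d + 2 * real l - 1) / (real d - 1) = (l + lam) / lam" for l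
    using lam_pos unfolding assms by (simp add: field_simps)
  then show ?thesis
    by (intro ext) (simp add: Rker_def R_def Qpoly_def Q_def flip: assms)
qed

end

section \<open>Rotation invariance of the surface measure\<close>

lemma borel_measurable_orthogonal_transformation:
  fixes f :: "'a::euclidean_space \<Rightarrow> 'a"
  assumes "orthogonal_transformation f"
  shows "f \<in> borel_measurable borel"
  using orthogonal_transformation_linear[OF assms]
  by (intro borel_measurable_continuous_onI linear_continuous_on linear_conv_bounded_linear[THEN iffD1])

text \<open>By translation invariance and Fubini's theorem, \<open>\<lambda>(f -` A) \<lambda>(B) = \<lambda>(A) \<lambda>(f -` B)\<close> for all
  Borel sets \<open>A\<close> and \<open>B\<close>; take for \<open>B\<close> the unit ball.\<close>

lemma emeasure_vimage_orthogonal: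
  fixes f :: "'a::euclidean_space \<Rightarrow> 'a"
  assumes f: "orthogonal_transformation f" and [measurable]: "A \<in> sets borel"
  shows "emeasure lborel (f -` A) = emeasure lborel A"
proof -
  have bij: "bij f" and lin: "linear f" and norm: "norm (f x) = norm x" for x
    using f by (auto intro: orthogonal_transformation_bij orthogonal_transformation_linear
        orthogonal_transformation_norm)
  define g where "g = inv f"
  have fg: "f (g y) = y" for y
    using bij by (simp add: g_def bij_is_surj surj_f_inv_f)
  have [measurable]: "f \<in> borel_measurable borel"
    using f by (rule borel_measurable_orthogonal_transformation)
  define B :: "'a set" where "B = ball 0 1"
  have [measurable]: "B \<in> sets borel" by (simp add: B_def)
  have fB: "f -` B = B" by (auto simp: B_def norm)
  have transl: "(\<integral>\<^sup>+x. h (c + x) \<partial>lborel) = (\<integral>\<^sup>+x. h x \<partial>lborel)"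
    if "h \<in> borel_measurable borel" for h :: "'a \<Rightarrow> ennreal" and c
    using nn_integral_distr[of "(+) c" lborel borel h] lborel_distr_plus[of c] that by simp
  have reflect: "(\<integral>\<^sup>+x. h (c - x) \<partial>lborel) = (\<integral>\<^sup>+x. h x \<partial>lborel)"
    if [measurable]: "h \<in> borel_measurable borel" for h :: "'a \<Rightarrow> ennreal" and c
    using nn_integral_distr[of "\<lambda>x. c + (-1) *\<^sub>R x" lborel borel h] lborel_affine[of "-1" c]
    by (simp add: density_1)
  have "emeasure lborel (f -` A) * emeasure lborel B
      = (\<integral>\<^sup>+x. (\<integral>\<^sup>+y. indicator A (f x) * indicator B y \<partial>lborel) \<partial>(lborel :: 'a measure))"
  proof -
    have "indicator A (f x) = (indicator (f -` A) x :: ennreal)" for x by (simp add: indicator_def)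
    moreover have "f -` A \<in> sets lborel"
      using measurable_sets_borel[of f borel A] by simp
    ultimately show ?thesis by (simp add: nn_integral_cmult nn_integral_multc)
  qed
  also have "\<dots> = (\<integral>\<^sup>+x. (\<integral>\<^sup>+y. indicator A (f x) * indicator B (f x + y) \<partial>lborel) \<partial>(lborel :: 'a measure))"
    by (intro nn_integral_cong transl[of "\<lambda>y. indicator A (f _) * indicator B y", symmetric]) measurable
  also have "\<dots> = (\<integral>\<^sup>+y. (\<integral>\<^sup>+x. indicator A (f x) * indicator B (f x + y) \<partial>lborel) \<partial>(lborel :: 'a measure))"
    by (rule lborel_pair.Fubini'[symmetric]) measurable
  \<comment> \<open>The shift of \<open>x\<close> by \<open>- g y\<close> is chosen so that
    \<open>f (- g y + x) = f x - y\<close>, which frees the factor for \<open>B\<close> from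
    \<open>y\<close>. A last substitution \<open>f x - y\<close> for \<open>y\<close> then separates
    the two integrals.\<close>
  also have "\<dots> = (\<integral>\<^sup>+y. (\<integral>\<^sup>+x. indicator A (f (- g y + x)) * indicator B (f (- g y + x) + y) \<partial>lborel) \<partial>(lborel :: 'a measure))"
    by (intro nn_integral_cong transl[of "\<lambda>x. indicator A (f x) * indicator B (f x + _)", symmetric]) measurable
  also have "\<dots> = (\<integral>\<^sup>+y. (\<integral>\<^sup>+x. indicator A (f x - y) * indicator B (f x) \<partial>lborel) \<partial>(lborel :: 'a measure))"
    by (simp add: linear_diff[OF lin] fg)
  also have "\<dots> = (\<integral>\<^sup>+x. (\<integral>\<^sup>+y. indicator A (f x - y) * indicator B (f x) \<partial>lborel) \<partial>(lborel :: 'a measure))"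
    by (rule lborel_pair.Fubini') measurable
  also have "\<dots> = (\<integral>\<^sup>+x. (\<integral>\<^sup>+y. indicator A y * indicator B (f x) \<partial>lborel) \<partial>(lborel :: 'a measure))"
    by (intro nn_integral_cong reflect[of "\<lambda>y. indicator A y * indicator B (f _)"]) measurable
  also have "\<dots> = emeasure lborel A * emeasure lborel B"
  proof -
    have "indicator B (f x) = (indicator B x :: ennreal)" for x
      using fB by (auto simp: indicator_def)
    then show ?thesis by (simp add: nn_integral_cmult nn_integral_multc)
  qed
  finally have eq: "emeasure lborel B * emeasure lborel (f -` A) = emeasure lborel B * emeasure lborel A"
    by (simp only: mult.commute)
  have "emeasure lborel B \<noteq> 0" "emeasure lborel B \<noteq> top"
    using unit_ball_vol_pos[of "real DIM('a)"] by (auto simp: B_def emeasure_ball simp del: unit_ball_vol_pos)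
  with eq show ?thesis
    by (simp only: ennreal_mult_cancel_left) blast
qed


section \<open>Support and invariance of the surface measure\<close>

lemma sets_sphere_measure [simp, measurable_cong]: "sets sphere_measure = sets borel"
  by (simp add: sphere_measure_def)

lemma space_sphere_measure [simp]: "space sphere_measure = UNIV"
  by (simp add: sphere_measure_def)

lemma emeasure_ball_01:
  "emeasure lborel (ball (0::'a::euclidean_space) 1) \<noteq> 0"
  "emeasure lborel (ball (0::'a::euclidean_space) 1) \<noteq> \<infinity>"
  using unit_ball_vol_pos[of "real DIM('a)"] by (auto simp: emeasure_ball simp del: unit_ball_vol_pos)

interpretation sphere: prob_space "sphere_measure :: 'a::euclidean_space measure"
  unfolding sphere_measure_def
  by (intro prob_space.prob_space_distr prob_space_uniform_measure emeasure_ball_01) simp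

text \<open>The measure lives on the whole space, so lying on the sphere is an almost everywhere
  statement; the radial projection misses the sphere only at the origin, a null set.\<close>

lemma AE_sphere_measure_norm: "AE y in (sphere_measure :: 'a::euclidean_space measure). norm y = 1"
proof -
  have "AE x in (lborel :: 'a measure). x \<noteq> 0"
    by (rule AE_lborel_singleton)
  then have "AE x in uniform_measure lborel (ball (0::'a) 1). norm (x /\<^sub>R norm x) = 1"
    by (intro AE_uniform_measureI) (auto elim!: eventually_mono)
  then show ?thesis
    unfolding sphere_measure_def by (subst AE_distr_iff) auto
qed

lemma integrable_sphere_measure:
  fixes f :: "'a::euclidean_space \<Rightarrow> real"
  assumes f: "continuous_on UNIV f"
  shows "integrable sphere_measure f"
proof -
  have "compact (f ` sphere 0 1)"
    using f by (intro compact_continuous_image) (auto intro: continuous_on_subset)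
  then obtain B where "\<And>y. y \<in> sphere 0 1 \<Longrightarrow> norm (f y) \<le> B"
    using compact_imp_bounded by (metis bounded_iff imageI)
  then have "AE y in sphere_measure. norm (f y) \<le> B"
    using AE_sphere_measure_norm by (auto elim: eventually_mono)
  moreover have "f \<in> borel_measurable sphere_measure"
    by (subst measurable_cong_sets[OF sets_sphere_measure refl]) (rule borel_measurable_continuous_onI[OF f])
  ultimately show ?thesis
    by (intro sphere.integrable_const_bound)
qed

text \<open>\<open>f\<close> preserves the uniform measure on the ball and commutes with radial
  projection.\<close>

lemma distr_sphere_measure_orthogonal:
  fixes f :: "'a::euclidean_space \<Rightarrow> 'a"
  assumes f: "orthogonal_transformation f"
  shows "distr sphere_measure borel f = sphere_measure"
proof -
  let ?B = "ball (0::'a) 1"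
  let ?U = "uniform_measure lborel ?B"
  have lin: "linear f" and norm: "norm (f x) = norm x" for x
    using f by (auto intro: orthogonal_transformation_linear orthogonal_transformation_norm)
  have [measurable]: "f \<in> borel_measurable borel"
    using f by (rule borel_measurable_orthogonal_transformation)
  have U: "distr ?U borel f = ?U"
  proof (rule measure_eqI)
    fix A assume "A \<in> sets (distr ?U borel f)"
    then have [measurable]: "A \<in> sets borel" by simp
    have "f -` A \<in> sets borel"
      using measurable_sets_borel[of f borel A] by simp
    moreover have "?B \<inter> f -` A = f -` (?B \<inter> A)"
      by (auto simp: norm)
    moreover have "emeasure lborel (f -` (?B \<inter> A)) = emeasure lborel (?B \<inter> A)"
      by (rule emeasure_vimage_orthogonal[OF f]) simp
    ultimately show "emeasure (distr ?U borel f) A = emeasure ?U A"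
      by (simp add: emeasure_distr del: vimage_Int)
  qed simp
  have "distr sphere_measure borel f = distr ?U borel (f \<circ> (\<lambda>x. x /\<^sub>R norm x))"
    unfolding sphere_measure_def by (subst distr_distr) simp_all
  also have "f \<circ> (\<lambda>x. x /\<^sub>R norm x) = (\<lambda>x. x /\<^sub>R norm x) \<circ> f"
    by (auto simp: norm linear_scale[OF lin])
  also have "distr ?U borel \<dots> = distr (distr ?U borel f) borel (\<lambda>x. x /\<^sub>R norm x)"
    by (subst distr_distr) simp_all
  also have "\<dots> = sphere_measure"
    by (simp only: U sphere_measure_def)
  finally show ?thesis .
qed

text \<open>For \<open>w = 0\<close> this is the identity, as division by zero yields \<open>0\<close>.\<close>

definition reflection :: "'a::real_inner \<Rightarrow> 'a \<Rightarrow> 'a" where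
  "reflection w y = y - (2 * (w \<bullet> y) / (w \<bullet> w)) *\<^sub>R w"

lemma orthogonal_transformation_reflection: "orthogonal_transformation (reflection w)"
proof -
  have "linear (reflection w)"
    by (rule linearI) (auto simp: reflection_def algebra_simps add_divide_distrib)
  moreover have "reflection w u \<bullet> reflection w v = u \<bullet> v" for u v
    by (cases "w = 0") (auto simp: reflection_def algebra_simps inner_commute)
  ultimately show ?thesis
    by (simp add: orthogonal_transformation_def)
qed

lemma inner_reflection:
  "v \<bullet> reflection v y = - (v \<bullet> y)"
  "u \<bullet> v = 0 \<Longrightarrow> u \<bullet> reflection v y = u \<bullet> y"
  by (cases "v = 0"; simp add: reflection_def algebra_simps)+

text \<open>The hyperplane orthogonal to \<open>x - z\<close> bisects two vectors of equal length.
  Hence reflections act transitively on each sphere.\<close>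

lemma reflection_diff_swap:
  assumes "norm x = norm z"
  shows "reflection (x - z) x = z"
proof (cases "x = z")
  case False
  have "x \<bullet> x = z \<bullet> z" using assms by (simp add: norm_eq)
  then have "(x - z) \<bullet> (x - z) = 2 * ((x - z) \<bullet> x)"
    by (simp add: algebra_simps inner_commute)
  moreover have "(x - z) \<bullet> (x - z) \<noteq> 0" using False by simp
  ultimately show ?thesis
    by (simp add: reflection_def)
qed (simp add: reflection_def)

lemma integral_sphere_measure_orthogonal:
  fixes f :: "'a::euclidean_space \<Rightarrow> 'a" and h :: "'a \<Rightarrow> real"
  assumes "orthogonal_transformation f" and [measurable]: "h \<in> borel_measurable borel"
  shows "(\<integral>y. h (f y) \<partial>sphere_measure) = (\<integral>y. h y \<partial>sphere_measure)"
proof -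
  have [measurable]: "f \<in> borel_measurable borel"
    using assms(1) by (rule borel_measurable_orthogonal_transformation)
  show ?thesis
    using integral_distr[of f sphere_measure borel h] distr_sphere_measure_orthogonal[OF assms(1)]
    by simp
qed

section \<open>The law of a coordinate\<close>

definition zonal_measure :: "'a::euclidean_space \<Rightarrow> real measure" where
  "zonal_measure x = distr sphere_measure borel ((\<bullet>) x)"

text \<open>The reflection taking \<open>x\<close> to \<open>z\<close> preserves inner products and
  the surface measure.\<close>

lemma zonal_measure_cong:
  fixes x z :: "'a::euclidean_space"
  assumes "norm x = norm z"
  shows "zonal_measure x = zonal_measure z"
proof -
  have R: "orthogonal_transformation (reflection (x - z))"
    by (rule orthogonal_transformation_reflection)
  then have [measurable]: "reflection (x - z) \<in> borel_measurable borel"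
    by (rule borel_measurable_orthogonal_transformation)
  have "z \<bullet> reflection (x - z) y = x \<bullet> y" for y
    using R reflection_diff_swap[OF assms] by (metis orthogonal_transformation_def)
  then have "zonal_measure x = distr sphere_measure borel ((\<bullet>) z \<circ> reflection (x - z))"
    by (simp add: zonal_measure_def comp_def)
  also have "\<dots> = distr (distr sphere_measure borel (reflection (x - z))) borel ((\<bullet>) z)"
    by (subst distr_distr) simp_all
  also have "\<dots> = zonal_measure z"
    by (simp add: zonal_measure_def distr_sphere_measure_orthogonal[OF R])
  finally show ?thesis .
qed

section \<open>Integration by parts on the sphere\<close>

text \<open>Reflection in the hyperplane orthogonal to \<open>v\<close> changes the sign of
  \<open>v \<bullet> y\<close> and fixes \<open>u \<bullet> y\<close>, so the integral equals its
  negative.\<close>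

lemma integral_sphere_measure_eq_0:
  fixes u v :: "'a::euclidean_space"
  assumes "u \<bullet> v = 0"
  shows "(\<integral>y. (v \<bullet> y) * (u \<bullet> y) ^ m \<partial>sphere_measure) = 0"
  using integral_sphere_measure_orthogonal[OF orthogonal_transformation_reflection[of v],
      of "\<lambda>y. (v \<bullet> y) * (u \<bullet> y) ^ m"] assms
  by (simp add: inner_reflection)

text \<open>The integral of \<open>(v \<bullet> y) (u \<bullet> y)\<^sup>m\<close> with \<open>u = a + s b\<close> and
  \<open>v = b - s a\<close> vanishes for all \<open>s\<close>; compare the coefficients of \<open>s\<close>.\<close>

lemma sphere_moment_rec:
  fixes a b :: "'a::euclidean_space"
  assumes ab: "a \<in> Basis" "b \<in> Basis" "a \<noteq> b"
  shows "(\<integral>y. (a \<bullet> y) ^ (m + 2) \<partial>sphere_measure)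
       = (real m + 1) * (\<integral>y. (b \<bullet> y)^2 * (a \<bullet> y) ^ m \<partial>sphere_measure)"
proof -
  define I where "I i j = (\<integral>y. (b \<bullet> y) ^ i * (a \<bullet> y) ^ j \<partial>sphere_measure)" for i j
  have int [simp]: "integrable sphere_measure (\<lambda>y. (b \<bullet> y) ^ i * (a \<bullet> y) ^ j)" for i j
    by (intro integrable_sphere_measure continuous_intros)
  let ?M = "Suc m"
  define p where "p = (\<Sum>i\<le>?M. monom (real (?M choose i) * I (Suc i) (?M - i)) i)
     - (\<Sum>i\<le>?M. monom (real (?M choose i) * I i (Suc (?M - i))) (Suc i))"
  have "poly p s = 0" for s
  proof -
    have "(a + s *\<^sub>R b) \<bullet> (b - s *\<^sub>R a) = 0"
      using ab by (simp add: algebra_simps inner_Basis)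
    then have "0 = (\<integral>y. ((b - s *\<^sub>R a) \<bullet> y) * ((a + s *\<^sub>R b) \<bullet> y) ^ ?M \<partial>sphere_measure)"
      using integral_sphere_measure_eq_0 by metis
    also have "\<dots> = (\<integral>y. (\<Sum>i\<le>?M. (?M choose i) * s ^ i * ((b \<bullet> y) ^ Suc i * (a \<bullet> y) ^ (?M - i)))
        - (\<Sum>i\<le>?M. (?M choose i) * s ^ Suc i * ((b \<bullet> y) ^ i * (a \<bullet> y) ^ Suc (?M - i))) \<partial>sphere_measure)"
    proof (intro Bochner_Integration.integral_cong refl)
      fix y
      have "((b - s *\<^sub>R a) \<bullet> y) * ((a + s *\<^sub>R b) \<bullet> y) ^ ?M
          = ((b \<bullet> y) - s * (a \<bullet> y)) * (s * (b \<bullet> y) + (a \<bullet> y)) ^ ?M"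
        by (simp add: inner_add_left inner_diff_left add.commute)
      also have "\<dots> = ((b \<bullet> y) - s * (a \<bullet> y)) * (\<Sum>i\<le>?M. (?M choose i) * (s * (b \<bullet> y)) ^ i * (a \<bullet> y) ^ (?M - i))"
        by (simp only: binomial_ring)
      also have "\<dots> = (\<Sum>i\<le>?M. (?M choose i) * s ^ i * ((b \<bullet> y) ^ Suc i * (a \<bullet> y) ^ (?M - i)))
          - (\<Sum>i\<le>?M. (?M choose i) * s ^ Suc i * ((b \<bullet> y) ^ i * (a \<bullet> y) ^ Suc (?M - i)))"
        unfolding left_diff_distrib sum_distrib_left sum_subtractf
        by (intro arg_cong2[where f = "(-)"] sum.cong refl) (simp_all add: power_mult_distrib)
      finally show "((b - s *\<^sub>R a) \<bullet> y) * ((a + s *\<^sub>R b) \<bullet> y) ^ ?M = \<dots>" .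
    qed
    also have "\<dots> = poly p s"
      by (simp add: p_def poly_sum poly_monom I_def mult_ac del: power_Suc sum.atMost_Suc)
    finally show ?thesis by simp
  qed
  then have "p = 0"
    using poly_all_0_iff_0 by blast
  \<comment> \<open>The coefficient of \<open>s\<close> takes \<open>i = 1\<close> from the first
    sum of \<open>p\<close> and \<open>i = 0\<close> from the second, where the power is shifted by
    one.\<close>
  then have "coeff p 1 = 0" by simp
  then have "(real m + 1) * I 2 m - I 0 (m + 2) = 0"
    by (simp add: add.commute p_def coeff_sum coeff_monom numeral_2_eq_2 del: sum.atMost_Suc)
  then show ?thesis by (simp add: I_def algebra_simps)
qed

text \<open>On the sphere, \<open>1 - (a \<bullet> y)^2\<close> is the sum of the squares of the
  other coordinates, and \<open>sphere_moment_rec\<close> gives the same value for each of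
  them.\<close>

lemma sphere_moment_by_parts:
  fixes a :: "'a::euclidean_space"
  assumes a: "a \<in> Basis"
  shows "real (DIM('a) - 1) * (\<integral>y. (a \<bullet> y) ^ (m + 2) \<partial>sphere_measure)
       = (real m + 1) * (\<integral>y. (1 - (a \<bullet> y)^2) * (a \<bullet> y) ^ m \<partial>sphere_measure)"
proof -
  have "(\<Sum>b\<in>Basis - {a}. (b \<bullet> y)^2) = 1 - (a \<bullet> y)^2" if "norm y = 1" for y
  proof -
    have "1 = y \<bullet> y" using that by (simp add: norm_eq_1)
    also have "\<dots> = (\<Sum>b\<in>Basis. (b \<bullet> y)^2)"
      by (subst euclidean_inner) (simp add: power2_eq_square inner_commute)
    finally show ?thesis using a by (simp add: sum.remove)
  qed
  then have AE: "AE y in sphere_measure. (1 - (a \<bullet> y)^2) * (a \<bullet> y) ^ m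
      = (\<Sum>b\<in>Basis - {a}. (b \<bullet> y)^2 * (a \<bullet> y) ^ m)"
    using AE_sphere_measure_norm by (auto simp: sum_distrib_right[symmetric] elim!: eventually_mono)
  have "(\<integral>y. (1 - (a \<bullet> y)^2) * (a \<bullet> y) ^ m \<partial>sphere_measure)
      = (\<integral>y. (\<Sum>b\<in>Basis - {a}. (b \<bullet> y)^2 * (a \<bullet> y) ^ m) \<partial>sphere_measure)"
    by (rule integral_cong_AE) (simp_all add: AE)
  also have "\<dots> = (\<Sum>b\<in>Basis - {a}. (\<integral>y. (b \<bullet> y)^2 * (a \<bullet> y) ^ m \<partial>sphere_measure))"
    by (intro Bochner_Integration.integral_sum integrable_sphere_measure continuous_intros)
  finally have "(real m + 1) * (\<integral>y. (1 - (a \<bullet> y)^2) * (a \<bullet> y) ^ m \<partial>sphere_measure)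
      = (\<Sum>b\<in>Basis - {a}. (real m + 1) * (\<integral>y. (b \<bullet> y)^2 * (a \<bullet> y) ^ m \<partial>sphere_measure))"
    by (simp add: sum_distrib_left)
  also have "\<dots> = (\<Sum>b\<in>Basis - {a}. (\<integral>y. (a \<bullet> y) ^ (m + 2) \<partial>sphere_measure))"
    using a by (intro sum.cong refl sphere_moment_rec[symmetric]) auto
  finally show ?thesis using a by simp
qed

text \<open>Both sides are linear in \<open>g\<close>. For monomials of positive degree this is
  \<open>sphere_moment_by_parts\<close>; for constants the coordinate has mean 0.\<close>

lemma sphere_integration_by_parts:
  fixes a :: "'a::euclidean_space" and g :: "real poly"
  assumes a: "a \<in> Basis"
  shows "(\<integral>y. (1 - (a \<bullet> y)^2) * poly (pderiv g) (a \<bullet> y) \<partial>sphere_measure)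
       = real (DIM('a) - 1) * (\<integral>y. (a \<bullet> y) * poly g (a \<bullet> y) \<partial>sphere_measure)"
proof -
  let ?D = "real (DIM('a) - 1)"
  have int: "integrable sphere_measure (\<lambda>y. (1 - (a \<bullet> y)^2) * poly p (a \<bullet> y))"
    "integrable sphere_measure (\<lambda>y. (a \<bullet> y) * poly p (a \<bullet> y))" for p
    by (intro integrable_sphere_measure continuous_intros)+
  define J where "J g = (\<integral>y. (1 - (a \<bullet> y)^2) * poly (pderiv g) (a \<bullet> y) \<partial>sphere_measure)
      - ?D * (\<integral>y. (a \<bullet> y) * poly g (a \<bullet> y) \<partial>sphere_measure)" for g
  have add: "J (p + q) = J p + J q" for p q
    by (simp add: J_def pderiv_add distrib_left int)
  have monom: "J (monom c k) = 0" for c k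
  proof (cases k)
    case 0
    have "(\<integral>y. (a \<bullet> y) * (0 \<bullet> y) ^ 0 \<partial>sphere_measure) = 0"
      by (rule integral_sphere_measure_eq_0) simp
    then show ?thesis using 0 by (simp add: J_def monom_0 mult.commute)
  next
    case (Suc m)
    have "J (monom c k) = c * ((real m + 1) * (\<integral>y. (1 - (a \<bullet> y)^2) * (a \<bullet> y) ^ m \<partial>sphere_measure)
      - ?D * (\<integral>y. (a \<bullet> y) ^ (m + 2) \<partial>sphere_measure))"
      unfolding J_def Suc pderiv_monom poly_monom
      by (simp add: right_diff_distrib mult_ac add_ac flip: integral_mult_right_zero)
    then show ?thesis using sphere_moment_by_parts[OF a, of m] by simp
  qed
  have "J (\<Sum>i\<in>I. monom (coeff g i) i) = 0" if "finite I" for I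
    using that
  proof (induction I rule: finite_induct)
    case empty
    then show ?case using monom[of 0 0] by simp
  qed (simp add: add monom)
  from this[of "{..degree g}"] show ?thesis
    by (simp add: poly_as_sum_of_monoms J_def)
qed

lemma gegenbauer_functional_zonal:
  fixes a :: "'a::euclidean_space"
  assumes "norm a = 1" and d: "DIM('a) \<ge> 3"
  shows "gegenbauer_functional (zonal_measure a) ((real (DIM('a)) - 2) / 2)"
proof -
  \<comment> \<open>The moment identities are available for basis vectors only; by
    \<open>zonal_measure_cong\<close> every unit vector yields the same law.\<close>
  obtain b :: 'a where b: "b \<in> Basis" using nonempty_Basis by blast
  have ab: "zonal_measure a = zonal_measure b"
    using assms b by (intro zonal_measure_cong) simp
  have sets: "sets (zonal_measure b) = sets borel" by (simp add: zonal_measure_def)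
  interpret Z: prob_space "zonal_measure b"
    unfolding zonal_measure_def by (rule sphere.prob_space_distr) simp
  show ?thesis
    unfolding ab
  proof
    show "AE t in zonal_measure b. \<bar>t\<bar> \<le> 1"
    proof -
      have "\<bar>b \<bullet> y\<bar> \<le> 1" if "norm y = 1" for y
        using Cauchy_Schwarz_ineq2[of b y] b that by simp
      then show ?thesis
        unfolding zonal_measure_def using AE_sphere_measure_norm
        by (subst AE_distr_iff) (auto elim!: eventually_mono)
    qed
    show "(real (DIM('a)) - 2) / 2 > 0" using d by simp
    fix g :: "real poly"
    have [measurable]: "poly p \<in> borel_measurable borel" for p :: "real poly"
      by (intro borel_measurable_continuous_onI continuous_intros)
    have "2 * ((real (DIM('a)) - 2) / 2) + 1 = real (DIM('a) - 1)"
      using d by (simp add: of_nat_diff field_simps)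
    then show "(\<integral>t. (1 - t^2) * poly (pderiv g) t \<partial>zonal_measure b)
       = (2 * ((real (DIM('a)) - 2) / 2) + 1) * (\<integral>t. t * poly g t \<partial>zonal_measure b)"
      using sphere_integration_by_parts[OF b, of g]
      by (simp only:) (simp add: zonal_measure_def integral_distr)
  qed (fact sets)
qed

text \<open>After Fubini the inner integral does not depend on the unit vector \<open>x\<close>, and
  the outer measure has total mass 1.\<close>

lemma nn_integral_pair_inner_sphere:
  fixes g :: "real \<Rightarrow> ennreal" and a :: "'a::euclidean_space"
  assumes [measurable]: "g \<in> borel_measurable borel" and a: "norm a = 1"
  shows "(\<integral>\<^sup>+y. g (y 0 \<bullet> y 1) \<partial>PiM {..<2::nat} (\<lambda>_. sphere_measure :: 'a measure))
       = (\<integral>\<^sup>+t. g t \<partial>zonal_measure a)"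
proof -
  interpret P: product_sigma_finite "\<lambda>_::nat. sphere_measure :: 'a measure" by standard
  have 2: "{..<2::nat} = {0, 1}" by auto
  have "(\<integral>\<^sup>+y. g (y 0 \<bullet> y 1) \<partial>PiM {..<2::nat} (\<lambda>_. sphere_measure :: 'a measure))
      = (\<integral>\<^sup>+z. g (fst z \<bullet> snd z) \<partial>((sphere_measure :: 'a measure) \<Otimes>\<^sub>M sphere_measure))"
    unfolding 2 by (rule P.product_nn_integral_pair) simp_all
  also have "\<dots> = (\<integral>\<^sup>+x. \<integral>\<^sup>+y. g (x \<bullet> y) \<partial>(sphere_measure :: 'a measure) \<partial>sphere_measure)"
    by (subst sphere.nn_integral_fst[symmetric]) simp_all
  also have "\<dots> = (\<integral>\<^sup>+x. (\<integral>\<^sup>+t. g t \<partial>zonal_measure a) \<partial>(sphere_measure :: 'a measure))"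
  proof (rule nn_integral_cong_AE)
    show "AE x in (sphere_measure :: 'a measure). (\<integral>\<^sup>+y. g (x \<bullet> y) \<partial>sphere_measure) = (\<integral>\<^sup>+t. g t \<partial>zonal_measure a)"
      using AE_sphere_measure_norm
    proof (rule eventually_mono)
      fix x :: 'a assume "norm x = 1"
      then have "zonal_measure a = zonal_measure x" using a by (intro zonal_measure_cong) simp
      then show "(\<integral>\<^sup>+y. g (x \<bullet> y) \<partial>sphere_measure) = (\<integral>\<^sup>+t. g t \<partial>zonal_measure a)"
        by (simp add: zonal_measure_def nn_integral_distr)
    qed
  qed
  also have "\<dots> = (\<integral>\<^sup>+t. g t \<partial>zonal_measure a)"
    by (simp add: sphere.emeasure_space_1[simplified])
  finally show ?thesis .
qed

section \<open>Two-point correlations of the harmonic ensemble\<close>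

lemma ldet_2: "ldet 2 A = A 0 0 * A 1 1 - A 0 1 * A 1 0"
proof -
  have "{..<2::nat} = {0, 1}" by auto
  moreover have "{p. p permutes {0, 1::nat}} = {id, Transposition.transpose 0 1}"
    by (auto simp: permutes_doubleton_iff)
  moreover have "id \<noteq> Transposition.transpose 0 (1::nat)"
    by (metis id_apply transpose_apply_first zero_neq_one)
  ultimately show ?thesis
    by (simp add: ldet_def sign_swap_id)
qed

text \<open>Turns the index set of \<open>harmonic_ensemble\<close> for \<open>k = 2\<close> into
  ordered pairs of distinct labels.\<close>

lemma sum_inj_on_lessThan_2:
  fixes F :: "'a \<Rightarrow> 'a \<Rightarrow> 'b::comm_monoid_add"
  shows "(\<Sum>i\<in>{i\<in>{..<2::nat} \<rightarrow>\<^sub>E S. inj_on i {..<2}}. F (i 0) (i 1))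
     = (\<Sum>(a, b)\<in>{(a, b)\<in>S \<times> S. a \<noteq> b}. F a b)"
proof -
  have 2: "{..<2::nat} = {0, 1}" by auto
  show ?thesis
    unfolding 2
  proof (rule sum.reindex_bij_witness[where i = "\<lambda>(a, b). \<lambda>j\<in>{0, 1}. if j = 0 then a else b"
        and j = "\<lambda>i. (i 0, i 1)"])
    fix i assume "i \<in> {i \<in> {0, 1::nat} \<rightarrow>\<^sub>E S. inj_on i {0, 1}}"
    then show "(case (i 0, i 1) of (a, b) \<Rightarrow> \<lambda>j\<in>{0, 1}. if j = 0 then a else b) = i"
      by (auto simp: fun_eq_iff PiE_def extensional_def restrict_def)
  qed (auto simp: PiE_iff)
qed

lemma card_offdiagonal: "card {(a, b)\<in>{..<n} \<times> {..<n}. a \<noteq> b} = n * n - (n::nat)"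
proof -
  have eq: "{(a, b)\<in>{..<n} \<times> {..<n}. a \<noteq> b} = {..<n} \<times> {..<n} - (\<lambda>i. (i, i)) ` {..<n}"
    by auto
  moreover have "card ((\<lambda>i. (i, i)) ` {..<n}) = n"
    by (subst card_image) (auto simp: inj_on_def)
  ultimately show ?thesis
    unfolding eq by (subst card_Diff_subset) (auto simp: card_cartesian_product)
qed

section \<open>The kernel at 1 and the dimension\<close>

text \<open>Pascal's rule for both binomials. The increment is the dimension of the spherical
  harmonics of degree \<open>L + 1\<close>.\<close>

lemma harm_dim_Suc:
  assumes "d \<ge> 1"
  shows "harm_dim d (Suc L) = harm_dim d L + ((d + L) choose (d - 1)) + ((d + L - 1) choose (d - 1))"
  using assms by (cases d) (auto simp: harm_dim_def)

text \<open>With \<open>e = d - 2\<close> the parameter is \<open>(d - 1) / 2\<close>;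
  \<open>gegenbauer_at_1_Suc\<close> has the same ratio as consecutive binomials.\<close>

lemma gegenbauer_at_1: "gegenbauer ((real e + 1) / 2) l 1 = (l + e) choose e"
proof (induction l)
  case (Suc l)
  have "(real l + 1) * gegenbauer ((real e + 1) / 2) (Suc l) 1 = (real l + e + 1) * ((l + e) choose e)"
    using gegenbauer_at_1_Suc[of l "(real e + 1) / 2"] Suc by (simp add: add_ac)
  also have "\<dots> = real (Suc (l + e) * ((l + e) choose l))"
    using binomial_symmetric[of e "l + e"] by (simp add: algebra_simps)
  also have "\<dots> = real (Suc l * (Suc (l + e) choose Suc l))"
    by (simp only: Suc_times_binomial)
  also have "\<dots> = (real l + 1) * ((Suc l + e) choose e)"
    using binomial_symmetric[of e "Suc l + e"] by (simp add: algebra_simps del: binomial_Suc_Suc)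
  finally show ?case by simp
qed simp

lemma Rker_at_1:
  assumes "d \<ge> 2"
  shows "Rker d L 1 = harm_dim d L"
proof -
  define e where "e = d - 2"
  have d: "d = e + 2" using assms by (simp add: e_def)
  have Q: "Qpoly d l 1 = (real e + 1 + 2 * l) / (real e + 1) * ((l + e) choose e)" for l
    using gegenbauer_at_1[of e l] by (simp add: Qpoly_def d add_ac)
  show ?thesis
  proof (induction L)
    case 0
    then show ?case by (simp add: Rker_def Q) (simp add: harm_dim_def d)
  next
    case (Suc L)
    \<comment> \<open>Both summands of the increment of \<open>harm_dim\<close> are multiples of
      this binomial: \<open>e + 1\<close> times them is \<open>(L + e + 2) * c\<close> and
      \<open>(L + 1) * c\<close>, with sum \<open>(e + 3 + 2 * L) * c\<close>.\<close>
    define c where "c = real ((Suc L + e) choose e)"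
    have dL: "(d + L) choose (d - 1) = ((Suc L + e) choose e) + ((Suc L + e) choose Suc e)"
      "(d + L - 1) choose (d - 1) = (Suc L + e) choose Suc e"
      by (simp_all add: d add_ac)
    have "real (Suc e * (Suc (Suc L + e) choose Suc e)) = real (Suc (Suc L + e) * ((Suc L + e) choose e))"
      by (simp only: Suc_times_binomial)
    then have 1: "(real e + 1) * ((d + L) choose (d - 1)) = (real L + e + 2) * c"
      unfolding dL c_def by (simp only: of_nat_mult of_nat_Suc of_nat_add binomial_Suc_Suc) algebra
    then have 2: "(real e + 1) * ((d + L - 1) choose (d - 1)) = (real L + 1) * c"
      unfolding dL c_def of_nat_add by algebra
    have "(real e + 1) * Qpoly d (Suc L) 1 = (real e + 3 + 2 * L) * c"
      unfolding Q c_def[symmetric] by (simp add: add_ac)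
    also have "\<dots> = (real e + 1) * (real ((d + L) choose (d - 1)) + ((d + L - 1) choose (d - 1)))"
      using 1 2 by (simp add: algebra_simps)
    finally have "(real e + 1) * Qpoly d (Suc L) 1
       = (real e + 1) * (real ((d + L) choose (d - 1)) + ((d + L - 1) choose (d - 1)))" .
    then have "Qpoly d (Suc L) 1 = real ((d + L) choose (d - 1)) + ((d + L - 1) choose (d - 1))"
      by simp
    then show ?case
      using Suc assms by (simp add: Rker_def harm_dim_Suc)
  qed
qed

lemma measurable_inner_PiM_sphere [measurable]:
  "(\<lambda>y. y a \<bullet> y b) \<in> borel_measurable (PiM I (\<lambda>_. sphere_measure :: 'a::euclidean_space measure))"
  if "a \<in> I" "b \<in> I"
  using that by (intro borel_measurable_inner) (simp_all add: measurable_cong_sets[OF refl sets_sphere_measure[symmetric]])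

text \<open>The defining property for \<open>k = 2\<close>. Almost everywhere both points have norm
  1, so the diagonal entries of the determinant are \<open>Rker d L 1\<close>, and the integrand
  depends on the inner product only.\<close>

lemma harmonic_ensemble_pair_correlation:
  fixes X :: "'w \<Rightarrow> nat \<Rightarrow> 'a::euclidean_space" and g :: "real \<Rightarrow> ennreal"
  assumes X: "harmonic_ensemble d L n M X" and e: "norm (e :: 'a) = 1"
    and [measurable]: "g \<in> borel_measurable borel"
  shows "(\<integral>\<^sup>+\<omega>. (\<Sum>(a, b)\<in>{(a, b)\<in>{..<n} \<times> {..<n}. a \<noteq> b}. g (X \<omega> a \<bullet> X \<omega> b)) \<partial>M)
    = (\<integral>\<^sup>+t. ennreal ((Rker d L 1)^2 - (Rker d L t)^2) * g t \<partial>zonal_measure e)"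
proof -
  let ?P = "PiM {..<2::nat} (\<lambda>_. sphere_measure :: 'a measure)"
  have [measurable]: "Rker d L \<in> borel_measurable borel"
    unfolding Rker_def Qpoly_def gegenbauer_def
    by (intro borel_measurable_continuous_onI continuous_intros)
  have m: "(\<lambda>y. g (y 0 \<bullet> y 1)) \<in> borel_measurable ?P"
    by measurable
  have "(\<integral>\<^sup>+\<omega>. (\<Sum>(a, b)\<in>{(a, b)\<in>{..<n} \<times> {..<n}. a \<noteq> b}. g (X \<omega> a \<bullet> X \<omega> b)) \<partial>M)
      = (\<integral>\<^sup>+\<omega>. (\<Sum>i\<in>{i\<in>{..<2::nat} \<rightarrow>\<^sub>E {..<n}. inj_on i {..<2}}.
           g ((\<lambda>j\<in>{..<2}. X \<omega> (i j)) 0 \<bullet> (\<lambda>j\<in>{..<2}. X \<omega> (i j)) 1)) \<partial>M)"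
    unfolding sum_inj_on_lessThan_2[where S = "{..<n}" and F = "\<lambda>a b. g (X \<omega> a \<bullet> X \<omega> b)" for \<omega>, symmetric]
    by (intro nn_integral_cong sum.cong refl) simp
  also have "\<dots> = (\<integral>\<^sup>+y. ennreal (ldet 2 (\<lambda>a b. Rker d L (y a \<bullet> y b))) * g (y 0 \<bullet> y 1) \<partial>?P)"
    using X m unfolding harmonic_ensemble_def by blast
  also have "\<dots> = (\<integral>\<^sup>+y. ennreal ((Rker d L 1)^2 - (Rker d L (y 0 \<bullet> y 1))^2) * g (y 0 \<bullet> y 1) \<partial>?P)"
  proof (rule nn_integral_cong_AE)
    have "AE y in ?P. norm (y i) = 1" if "i < 2" for i
      using that by (intro AE_PiM_component[of "{..<2}" "\<lambda>_. sphere_measure"] AE_sphere_measure_norm sphere.prob_space_axioms) auto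
    then have "AE y in ?P. norm (y 0) = 1" "AE y in ?P. norm (y 1) = 1"
      by simp_all
    then show "AE y in ?P. ennreal (ldet 2 (\<lambda>a b. Rker d L (y a \<bullet> y b))) * g (y 0 \<bullet> y 1)
       = ennreal ((Rker d L 1)^2 - (Rker d L (y 0 \<bullet> y 1))^2) * g (y 0 \<bullet> y 1)"
      by eventually_elim (simp add: ldet_2 norm_eq_1 power2_eq_square inner_commute)
  qed
  also have "\<dots> = (\<integral>\<^sup>+t. ennreal ((Rker d L 1)^2 - (Rker d L t)^2) * g t \<partial>zonal_measure e)"
    by (rule nn_integral_pair_inner_sphere[OF _ e]) measurable
  finally show ?thesis .
qed

lemma expected_frame_potential_conv_zonal:
  fixes X :: "'w \<Rightarrow> nat \<Rightarrow> 'a::euclidean_space"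
  assumes d: "d \<ge> 2" "DIM('a) = d + 1" and X: "harmonic_ensemble d L (harm_dim d L) M X"
    and e: "norm (e :: 'a) = 1"
  shows "(\<integral>\<omega>. frame_potential (harm_dim d L) (X \<omega>) \<partial>M)
     = real (harm_dim d L) + (\<integral>t. ((Rker d L 1)^2 - (Rker d L t)^2) * t^2 \<partial>zonal_measure e)"
proof -
  define n where "n = harm_dim d L"
  define lam where "lam = (real d - 1) / 2"
  interpret Z: gegenbauer_functional "zonal_measure e" lam
    unfolding lam_def using gegenbauer_functional_zonal[OF e] d by simp
  interpret M: prob_space M using X by (simp add: harmonic_ensemble_def)
  have R: "Rker d L = Z.R L"
    by (rule Z.Rker_eq_R) (fact lam_def)
  have R1: "Z.R L 1 = n" using Rker_at_1[OF d(1), of L] by (simp add: R n_def)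
  define w where "w t = (Rker d L 1)^2 - (Rker d L t)^2" for t
  have w: "w t = n^2 - (Z.R L t)^2" for t by (simp add: w_def R R1)
  have cont [continuous_intros]: "continuous_on A w" for A
    unfolding w by (intro continuous_intros)
  then have [measurable]: "w \<in> borel_measurable borel"
    by (intro borel_measurable_continuous_onI)
  let ?D = "{(a, b)\<in>{..<n} \<times> {..<n}. a \<noteq> b}"
  have corr: "(\<integral>\<^sup>+\<omega>. (\<Sum>(a, b)\<in>?D. g (X \<omega> a \<bullet> X \<omega> b)) \<partial>M) = (\<integral>\<^sup>+t. ennreal (w t) * g t \<partial>zonal_measure e)"
    if "g \<in> borel_measurable borel" for g
    using harmonic_ensemble_pair_correlation[OF X e that] by (simp add: w_def n_def)

  txt \<open>In the definition of the ensemble, \<open>ennreal\<close> truncates negative values of the correlation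
    function \<open>w\<close>. Counting pairs shows that \<open>w\<close> and \<open>max 0 w\<close> have the same integral \<open>n (n - 1)\<close>,
    so \<open>w\<close> is nonnegative almost everywhere.\<close>
  have int_w: "(\<integral>t. w t \<partial>zonal_measure e) = real n^2 - real n"
    using Z.integral_R_R[of L]
    by (simp add: w R1 Z.prob_space Z.integrable_continuous continuous_intros flip: power2_eq_square)
  \<comment> \<open>The constant test function 1 counts the ordered pairs of distinct
    labels.\<close>
  have count: "(\<integral>\<^sup>+t. ennreal (w t) \<partial>zonal_measure e) = ennreal (real n^2 - real n)"
  proof -
    have "(\<integral>\<^sup>+t. ennreal (w t) \<partial>zonal_measure e) = (\<integral>\<^sup>+\<omega>. (\<Sum>(a, b)\<in>?D. 1) \<partial>M)"
      using corr[of "\<lambda>_. 1"] by simp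
    also have "\<dots> = of_nat (card ?D)"
      by (simp add: split_beta M.emeasure_space_1)
    also have "\<dots> = ennreal (real n^2 - real n)"
      unfolding card_offdiagonal by (simp add: ennreal_of_nat_eq_real_of_nat of_nat_diff power2_eq_square)
    finally show ?thesis .
  qed
  have "ennreal (\<integral>t. max 0 (w t) \<partial>zonal_measure e) = (\<integral>\<^sup>+t. ennreal (max 0 (w t)) \<partial>zonal_measure e)"
    by (rule nn_integral_eq_integral[symmetric])
      (auto intro!: Z.integrable_continuous continuous_intros)
  also have "\<dots> = (\<integral>\<^sup>+t. ennreal (w t) \<partial>zonal_measure e)"
    by (intro nn_integral_cong) (auto simp: max_def ennreal_neg)
  finally have "ennreal (\<integral>t. max 0 (w t) \<partial>zonal_measure e) = ennreal (real n^2 - real n)"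
    by (simp only: count)
  moreover have "real n^2 - real n \<ge> 0"
    by (simp add: power2_eq_square flip: of_nat_mult)
  moreover have "(\<integral>t. max 0 (w t) \<partial>zonal_measure e) \<ge> 0"
    by (intro integral_nonneg_AE) auto
  ultimately have "(\<integral>t. max 0 (w t) \<partial>zonal_measure e) = real n^2 - real n"
    by (simp only: ennreal_inj)
  moreover have "(\<integral>t. max 0 (w t) - w t \<partial>zonal_measure e)
      = (\<integral>t. max 0 (w t) \<partial>zonal_measure e) - (\<integral>t. w t \<partial>zonal_measure e)"
    by (intro Bochner_Integration.integral_diff Z.integrable_continuous continuous_intros)
  ultimately have "(\<integral>t. max 0 (w t) - w t \<partial>zonal_measure e) = 0"
    by (simp only: int_w diff_self)
  then have "AE t in zonal_measure e. max 0 (w t) - w t = 0"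
    by (subst (asm) integral_nonneg_eq_0_iff_AE) (auto intro!: Z.integrable_continuous continuous_intros)
  then have w_nonneg: "AE t in zonal_measure e. w t \<ge> 0"
    by (auto elim!: eventually_mono)

  have "(\<integral>\<^sup>+\<omega>. (\<Sum>(a, b)\<in>?D. ennreal ((X \<omega> a \<bullet> X \<omega> b)^2)) \<partial>M) = (\<integral>\<^sup>+t. ennreal (w t * t^2) \<partial>zonal_measure e)"
    using corr[of "\<lambda>t. ennreal (t^2)"] by (simp add: ennreal_mult'')
  also have "\<dots> = ennreal (\<integral>t. w t * t^2 \<partial>zonal_measure e)"
    using w_nonneg by (intro nn_integral_eq_integral Z.integrable_continuous continuous_intros) auto
  finally have offdiag: "(\<integral>\<^sup>+\<omega>. (\<Sum>(a, b)\<in>?D. ennreal ((X \<omega> a \<bullet> X \<omega> b)^2)) \<partial>M) = \<dots>" .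

  have [measurable]: "(\<lambda>\<omega>. X \<omega> i) \<in> borel_measurable M" if "i < n" for i
    using X that by (simp add: harmonic_ensemble_def n_def)
  have split: "frame_potential n x = n + (\<Sum>(a, b)\<in>?D. (x a \<bullet> x b)^2)" if "\<forall>i<n. norm (x i) = 1"
    for x :: "nat \<Rightarrow> 'a"
  proof -
    have "frame_potential n x = (\<Sum>(a, b)\<in>{..<n} \<times> {..<n}. (x a \<bullet> x b)^2)"
      by (simp add: frame_potential_def sum.cartesian_product)
    also have "{..<n} \<times> {..<n} = ?D \<union> (\<lambda>i. (i, i)) ` {..<n}" by auto
    also have "(\<Sum>(a, b)\<in>?D \<union> (\<lambda>i. (i, i)) ` {..<n}. (x a \<bullet> x b)^2)
        = (\<Sum>(a, b)\<in>?D. (x a \<bullet> x b)^2) + (\<Sum>(a, b)\<in>(\<lambda>i. (i, i)) ` {..<n}. (x a \<bullet> x b)^2)"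
      by (rule sum.union_disjoint) (auto intro: finite_subset[of _ "{..<n} \<times> {..<n}"])
    also have "(\<Sum>(a, b)\<in>(\<lambda>i. (i, i)) ` {..<n}. (x a \<bullet> x b)^2) = (\<Sum>i<n. (x i \<bullet> x i)^2)"
      by (subst sum.reindex) (auto simp: inj_on_def)
    also have "\<dots> = n"
      using that by (simp add: norm_eq_1)
    finally show ?thesis by simp
  qed
  have "AE \<omega> in M. \<forall>i<n. norm (X \<omega> i) = 1"
    using X by (auto simp: harmonic_ensemble_def n_def elim!: eventually_mono)
  then have "(\<integral>\<^sup>+\<omega>. ennreal (frame_potential n (X \<omega>)) \<partial>M)
      = (\<integral>\<^sup>+\<omega>. ennreal n + (\<Sum>(a, b)\<in>?D. ennreal ((X \<omega> a \<bullet> X \<omega> b)^2)) \<partial>M)"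
    by (intro nn_integral_cong_AE, eventually_elim)
      (simp add: split sum_nonneg split_beta flip: sum_ennreal)
  also have "\<dots> = ennreal n + ennreal (\<integral>t. w t * t^2 \<partial>zonal_measure e)"
    unfolding offdiag[symmetric]
    by (subst nn_integral_add) (auto simp: M.emeasure_space_1 split_beta)
  also have "\<dots> = ennreal (n + (\<integral>t. w t * t^2 \<partial>zonal_measure e))"
    using w_nonneg by (intro ennreal_plus[symmetric] integral_nonneg_AE) (auto elim!: eventually_mono)
  finally have FP: "(\<integral>\<^sup>+\<omega>. ennreal (frame_potential n (X \<omega>)) \<partial>M) = \<dots>" .
  \<comment> \<open>Nonnegativity allows the passage back from \<open>enn2real\<close> to the real
    integral.\<close>
  have "(\<integral>t. w t * t^2 \<partial>zonal_measure e) \<ge> 0"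
    using w_nonneg by (intro integral_nonneg_AE) (auto elim!: eventually_mono)
  moreover have "(\<integral>\<omega>. frame_potential n (X \<omega>) \<partial>M) = enn2real (\<integral>\<^sup>+\<omega>. ennreal (frame_potential n (X \<omega>)) \<partial>M)"
    by (intro integral_eq_nn_integral) (auto simp: frame_potential_def intro!: sum_nonneg borel_measurable_sum)
  ultimately show ?thesis
    unfolding FP n_def[symmetric] w_def[symmetric] by (simp del: ennreal_plus)
qed

section \<open>The expected frame potential\<close>

text \<open>With the integrals known, \<open>Z.Q L 1\<close>, \<open>Z.Q (L + 1) 1\<close> and the
  binomial are all written as rational multiples of \<open>c\<close>, which leaves a rational
  identity in \<open>d\<close> and \<open>L\<close>.\<close>

lemma expected_frame_potential:
  fixes X :: "'w \<Rightarrow> nat \<Rightarrow> 'a::euclidean_space"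
  assumes d: "d \<ge> 2" "DIM('a) = d + 1" and X: "harmonic_ensemble d L (harm_dim d L) M X"
  shows "(\<integral>\<omega>. frame_potential (harm_dim d L) (X \<omega>) \<partial>M)
     = real (harm_dim d L)^2 / (real d + 1)
       + (real d / (real L + real d)
          - real d * (real d - 1)
            / ((real d + real L) * (real d + 2 * real L + 1) * (real d + 2 * real L - 1)))
         * real ((d + L) choose d)"
proof -
  obtain e :: 'a where "e \<in> Basis" using nonempty_Basis by blast
  then have e: "norm e = 1" by simp
  define n where "n = harm_dim d L"
  define lam where "lam = (real d - 1) / 2"
  interpret Z: gegenbauer_functional "zonal_measure e" lam
    unfolding lam_def using gegenbauer_functional_zonal[OF e] d by simp
  have R: "Rker d L = Z.R L" for L
    by (rule Z.Rker_eq_R) (fact lam_def)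
  have R1: "Z.R L 1 = n" using Rker_at_1[OF d(1), of L] by (simp add: R n_def)
  define c where "c = gegenbauer lam L 1"
  have d2: "real d \<ge> 2" using d by simp
  have Q: "Z.Q l t = (real d + 2 * real l - 1) / (real d - 1) * gegenbauer lam l t" for l t
    using d2 unfolding Z.Q_def unfolding lam_def by (simp add: divide_simps) (simp add: algebra_simps)
  have Q1: "Z.Q L 1 = (real d + 2 * real L - 1) / (real d - 1) * c"
    by (simp only: Q c_def)
  have "gegenbauer lam (L + 1) 1 = (real L + real d - 1) / (real L + 1) * c"
    using gegenbauer_at_1_Suc[of L lam] by (simp add: c_def lam_def field_simps)
  then have Q2: "Z.Q (L + 1) 1 = (real d + 2 * real L + 1) / (real d - 1) * ((real L + real d - 1) / (real L + 1) * c)"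
    by (simp add: Q algebra_simps)
  \<comment> \<open>Case \<open>L = 0\<close> of \<open>integral_R2_t2\<close>, where
    \<open>Z.R 0\<close> is the constant 1.\<close>
  have t2: "(\<integral>t. t^2 \<partial>zonal_measure e) = 1 / (real d + 1)"
  proof -
    have "2 * lam = real d - 1" "Z.Q (Suc 0) 1 = real d + 1" "Z.Q 0 t = 1" for t
      using d2 by (simp_all add: Q) (simp_all add: lam_def divide_simps)
    then show ?thesis
      using Z.integral_R2_t2[of 0] by (simp add: Z.R_def power2_eq_square add.commute)
  qed
  have "(\<integral>t. ((Rker d L 1)^2 - (Rker d L t)^2) * t^2 \<partial>zonal_measure e)
      = (\<integral>t. n^2 * t^2 - (t * Z.R L t)^2 \<partial>zonal_measure e)"
    by (simp add: R R1 algebra_simps power_mult_distrib)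
  also have "\<dots> = n^2 * (\<integral>t. t^2 \<partial>zonal_measure e) - (\<integral>t. (t * Z.R L t)^2 \<partial>zonal_measure e)"
    by (subst Bochner_Integration.integral_diff) (auto intro!: Z.integrable_continuous continuous_intros)
  finally have "(\<integral>\<omega>. frame_potential n (X \<omega>) \<partial>M) = real n^2 / (real d + 1)
      + (1 - (L / (2 * (L + lam)))^2) * Z.Q L 1 - ((real L + 1) / (2 * (real L + 1 + lam)))^2 * Z.Q (L + 1) 1"
    using expected_frame_potential_conv_zonal[OF d X e] Z.integral_R2_t2[of L] by (simp add: R1 t2 n_def)
  moreover have "real ((d + L) choose d) = (real d + real L) * (real d + real L - 1) / (real d * (real d - 1)) * c"
  proof -
    define k where "k = d - 2"
    have dk: "d = k + 2" using d by (simp add: k_def)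
    have "lam = (real k + 1) / 2" by (simp add: lam_def dk)
    then have c: "c = (L + k) choose k" by (simp only: c_def gegenbauer_at_1)
    have "real (Suc (Suc k) * (Suc (Suc (L + k)) choose Suc (Suc k)))
        = real (Suc (Suc (L + k)) * (Suc (L + k) choose Suc k))"
      "real (Suc k * (Suc (L + k) choose Suc k)) = real (Suc (L + k) * ((L + k) choose k))"
      by (simp_all only: Suc_times_binomial)
    then have 1: "real (Suc (Suc (L + k)) choose Suc (Suc k))
          = (real L + k + 2) * real (Suc (L + k) choose Suc k) / (real k + 2)"
      and 2: "real (Suc (L + k) choose Suc k) = (real L + k + 1) * c / (real k + 1)"
      unfolding c of_nat_mult by (simp_all add: field_simps del: binomial_Suc_Suc)
    have 3: "(d + L) choose d = Suc (Suc (L + k)) choose Suc (Suc k)"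
      by (simp add: dk add.commute)
    show ?thesis
      unfolding 3 1 2 by (simp add: dk field_simps)
  qed
  moreover have "(1 - (L / (2 * (L + lam)))^2) * Z.Q L 1 - ((real L + 1) / (2 * (real L + 1 + lam)))^2 * Z.Q (L + 1) 1
     = (real d / (real L + real d) - real d * (real d - 1)
            / ((real d + real L) * (real d + 2 * real L + 1) * (real d + 2 * real L - 1)))
       * ((real d + real L) * (real d + real L - 1) / (real d * (real d - 1)) * c)"
  proof -
    have lam: "2 * (L + lam) = real d + 2 * real L - 1" "2 * (real L + 1 + lam) = real d + 2 * real L + 1"
      by (simp_all add: lam_def field_simps)
    define D l where "D = real d" and "l = real L"
    have "D \<ge> 2" "l \<ge> 0" using d by (simp_all add: D_def l_def)
    \<comment> \<open>These are \<open>2 * (L + lam)\<close> and \<open>2 * (L + 1 + lam)\<close>,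
      the denominators in \<open>integral_R2_t2\<close> and the numerators in \<open>Z.Q L 1\<close>
      and \<open>Z.Q (L + 1) 1\<close>.\<close>
    define A B where "A = D + 2 * l - 1" and "B = D + 2 * l + 1"
    have AB: "A \<noteq> 0" "B \<noteq> 0" "D + l \<noteq> 0" "D \<noteq> 0" "D - 1 \<noteq> 0" "l + 1 \<noteq> 0"
      using \<open>D \<ge> 2\<close> \<open>l \<ge> 0\<close> by (simp_all add: A_def B_def)
    have "(1 - (l / A)^2) * (A / (D - 1) * c) - ((l + 1) / B)^2 * (B / (D - 1) * ((l + D - 1) / (l + 1) * c))
        = (A^2 * B - l^2 * B - (l + 1) * (l + D - 1) * A) * c / ((D - 1) * A * B)"
      using AB by (simp add: divide_simps power2_eq_square) (simp add: algebra_simps)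
    also have "A^2 * B - l^2 * B - (l + 1) * (l + D - 1) * A = (D + l - 1) * A * B - (D + l - 1) * (D - 1)"
      unfolding A_def B_def by algebra
    also have "((D + l - 1) * A * B - (D + l - 1) * (D - 1)) * c / ((D - 1) * A * B)
        = (D / (l + D) - D * (D - 1) / ((D + l) * B * A)) * ((D + l) * (D + l - 1) / (D * (D - 1)) * c)"
    proof -
      have "(D / (l + D) - D * (D - 1) / ((D + l) * B * A)) * ((D + l) * (D + l - 1) / (D * (D - 1)) * c)
          = D / (D + l) * ((D + l) * (D + l - 1) / (D * (D - 1)) * c)
            - D * (D - 1) / ((D + l) * B * A) * ((D + l) * (D + l - 1) / (D * (D - 1)) * c)"
        by (simp only: left_diff_distrib add.commute[of l D])
      also have "\<dots> = (D + l - 1) / (D - 1) * c - (D + l - 1) / (B * A) * c"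
      proof -
        \<comment> \<open>The cancellation is stated for atoms and used with \<open>x = D\<close>,
          \<open>y = D - 1\<close>, \<open>m = D + l\<close>, \<open>k = D + l - 1\<close>.\<close>
        have "x / m * (m * k / (x * y) * c) - x * y / (m * B * A) * (m * k / (x * y) * c)
            = k / y * c - k / (B * A) * c"
          if "x \<noteq> 0" "y \<noteq> 0" "m \<noteq> 0" for x y m k
          using that AB by (simp add: field_simps)
        then show ?thesis using AB by blast
      qed
      finally show ?thesis
        using AB by (simp add: field_simps)
    qed
    finally show ?thesis
      unfolding Q1 Q2 lam D_def l_def A_def B_def .
  qed
  ultimately show ?thesis unfolding n_def by simp
qed

section \<open>The order of the remainder\<close>

text \<open>The bracket lies between 0 and \<open>d / (L + d)\<close>, which times the binomial is
  \<open>(d + L - 1) choose (d - 1)\<close>, at most \<open>(d + L) ^ (d - 1)\<close>. Since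
  \<open>harm_dim d L\<close> is at least \<open>((d + L) / d) ^ d\<close>, this has the claimed
  order.\<close>

lemma frame_potential_remainder_bound:
  assumes "d \<ge> 2"
  shows "\<bar>(real d / (real L + real d) - real d * (real d - 1)
            / ((real d + real L) * (real d + 2 * real L + 1) * (real d + 2 * real L - 1)))
         * real ((d + L) choose d)\<bar>
       \<le> real d ^ (d - 1) * real (harm_dim d L) powr ((real d - 1) / real d)"
proof -
  define D l where "D = real d" and "l = real L"
  have D: "D \<ge> 2" and l: "l \<ge> 0" using assms by (simp_all add: D_def l_def)
  define A where "A = (D + 2 * l + 1) * (D + 2 * l - 1)"
  have "A \<ge> (D + 2 * l + 1) * 1"
    unfolding A_def using D l by (intro mult_left_mono) auto
  then have A: "A \<ge> D - 1" "A > 0" using D l by auto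
  \<comment> \<open>The subtracted fraction is \<open>D / (l + D)\<close> times a number in
    \<open>[0, 1]\<close>.\<close>
  have eq: "D * (D - 1) / ((D + l) * (D + 2 * l + 1) * (D + 2 * l - 1)) = D / (l + D) * ((D - 1) / A)"
    by (simp add: A_def add.commute mult_ac)
  have "0 \<le> (D - 1) / A" "(D - 1) / A \<le> 1"
    using A D by (auto simp: divide_simps)
  then have "0 \<le> D / (l + D) * ((D - 1) / A)" "D / (l + D) * ((D - 1) / A) \<le> D / (l + D)"
    using D l by (intro mult_nonneg_nonneg mult_left_le; simp)+
  then have "\<bar>D / (l + D) - D * (D - 1) / ((D + l) * (D + 2 * l + 1) * (D + 2 * l - 1))\<bar> \<le> D / (l + D)"
    unfolding eq by linarith
  then have "\<bar>(D / (l + D) - D * (D - 1) / ((D + l) * (D + 2 * l + 1) * (D + 2 * l - 1)))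
      * real ((d + L) choose d)\<bar> \<le> D / (l + D) * real ((d + L) choose d)"
    unfolding abs_mult by (intro mult_mono) auto
  also have "\<dots> = real ((d + L - 1) choose (d - 1))"
  proof -
    have "real (d * ((d + L) choose d)) = real ((d + L) * ((d + L - 1) choose (d - 1)))"
      using assms by (subst times_binomial_minus1_eq) simp_all
    then show ?thesis using D l by (simp add: D_def l_def field_simps)
  qed
  also have "\<dots> \<le> real ((d + L) ^ (d - 1))"
  proof -
    have "(d + L - 1) choose (d - 1) \<le> (d + L - 1) ^ (d - 1)"
      by (rule binomial_le_pow) simp
    also have "\<dots> \<le> (d + L) ^ (d - 1)"
      by (intro power_mono) auto
    finally show ?thesis by (simp only: of_nat_le_iff)
  qed
  also have "\<dots> = D ^ (d - 1) * ((D + l) / D) ^ (d - 1)"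
    using D by (simp add: power_divide D_def l_def)
  also have "((D + l) / D) ^ (d - 1) = (((D + l) / D) ^ d) powr ((D - 1) / D)"
    using D l assms by (simp add: powr_realpow[symmetric] powr_powr of_nat_diff flip: D_def)
  also have "((D + l) / D) ^ d \<le> real (harm_dim d L)"
  proof -
    have "((D + l) / D) ^ d \<le> real ((d + L) choose d)"
      using binomial_ge_n_over_k_pow_k[of d "d + L", where 'a = real] by (simp add: D_def l_def)
    also have "\<dots> \<le> real (harm_dim d L)" by (simp add: harm_dim_def)
    finally show ?thesis .
  qed
  then have "D ^ (d - 1) * (((D + l) / D) ^ d) powr ((D - 1) / D)
      \<le> D ^ (d - 1) * real (harm_dim d L) powr ((D - 1) / D)"
    using D l by (intro mult_left_mono powr_mono2) auto
  finally show ?thesis by (simp only: D_def l_def)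
qed

theorem theorem1:
  fixes d :: nat
  assumes "d \<ge> 2" and "DIM('a::euclidean_space) = d + 1"
  shows "(\<forall>L (M :: 'w measure) (X :: 'w \<Rightarrow> nat \<Rightarrow> 'a).
            harmonic_ensemble d L (harm_dim d L) M X \<longrightarrow>
            (\<integral>\<omega>. frame_potential (harm_dim d L) (X \<omega>) \<partial>M)
              = real (harm_dim d L)^2 / (real d + 1)
                + (real d / (real L + real d)
                   - real d * (real d - 1)
                     / ((real d + real L) * (real d + 2 * real L + 1) * (real d + 2 * real L - 1)))
                  * real ((d + L) choose d))
       \<and> (\<exists>C. \<forall>L (M :: 'w measure) (X :: 'w \<Rightarrow> nat \<Rightarrow> 'a).
            harmonic_ensemble d L (harm_dim d L) M X \<longrightarrow>
            \<bar>(\<integral>\<omega>. frame_potential (harm_dim d L) (X \<omega>) \<partial>M) - real (harm_dim d L)^2 / (real d + 1)\<bar>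
              \<le> C * real (harm_dim d L) powr ((real d - 1) / real d))"
\<comment> \<open>The witness comes from \<open>frame_potential_remainder_bound\<close> and depends
  on \<open>d\<close> only, which makes the bound uniform in \<open>L\<close>.\<close>
proof (intro conjI exI[of _ "real d ^ (d - 1)"] allI impI)
  fix L and M :: "'w measure" and X :: "'w \<Rightarrow> nat \<Rightarrow> 'a"
  assume X: "harmonic_ensemble d L (harm_dim d L) M X"
  show "(\<integral>\<omega>. frame_potential (harm_dim d L) (X \<omega>) \<partial>M)
      = real (harm_dim d L)^2 / (real d + 1)
        + (real d / (real L + real d)
           - real d * (real d - 1)
             / ((real d + real L) * (real d + 2 * real L + 1) * (real d + 2 * real L - 1)))
          * real ((d + L) choose d)"
    by (rule expected_frame_potential[OF assms X])
  then show "\<bar>(\<integral>\<omega>. frame_potential (harm_dim d L) (X \<omega>) \<partial>M) - real (harm_dim d L)^2 / (real d + 1)\<bar>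
      \<le> real d ^ (d - 1) * real (harm_dim d L) powr ((real d - 1) / real d)"
    using frame_potential_remainder_bound[OF assms(1), of L] by simp
qed

end
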